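(* Let $PG$ be the Petersen graph and let $f:PG\to\mathbb{R}^{2}$ be a plane generic immersion. Then \[ \sum_{\gamma\in\Gamma_{5}(PG)}c(f(\gamma))\equiv\sum_{\gamma\in\Gamma_{6}(PG)}c(f(\gamma))\equiv\sum_{\gamma\in\Gamma_{9}(PG)}c(f(\gamma))\equiv 1\pmod 2 \] and \[ \sum_{\gamma\in\Gamma_{8}(PG)}c(f(\gamma))\equiv 0\pmod 4, \] where $\Gamma_k(PG)$ is the set of all $k$-cycles of $PG$.
   Context: The Petersen graph $PG$ has vertices $u_i,v_i$ ($i\in\mathbb{Z}/5\mathbb{Z}$) and the $15$ edges $u_iu_{i+1}$, $u_iv_i$, $v_iv_{i+2}$. A finite graph $G$ is regarded as a topological space in the usual way. A $k$-cycle of $G$ is a subgraph with $k$ edges that is homeomorphic to a circle (cycles are unoriented subgraphs). A plane generic immersion of $G$ is an immersion $f:G\to\mathbb{R}^2$ (a continuous locally injective, piecewise smooth map) whose multiple points are only finitely many transversal double points between edges, i.e. between interior points of edges (possibly of the same edge); these double points are called crossings. For a subgraph $H$ of $G$, $c(f(H))$ denotes the number of crossings of the restriction $f|_H$. *)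

theory Defs
  imports "HOL-Analysis.Analysis" "HOL-Number_Theory.Cong"
begin

record 'v ugraph =
  verts :: "'v set"
  edges :: "'v set set"

definition simple_graph :: "'v ugraph \<Rightarrow> bool" where
  "simple_graph G \<longleftrightarrow> finite (verts G) \<and> (\<forall>e\<in>edges G. e \<subseteq> verts G \<and> card e = 2)"

definition subgraph :: "'v ugraph \<Rightarrow> 'v ugraph \<Rightarrow> bool" where
  "subgraph H G \<longleftrightarrow> simple_graph H \<and> verts H \<subseteq> verts G \<and> edges H \<subseteq> edges G"

abbreviation vertex_point :: "'v::finite \<Rightarrow> real ^ 'v" where
  "vertex_point x \<equiv> axis x 1"

text \<open>The standard geometric realization: vertices become the unit coordinate vectors, and
  the edge between \<open>x\<close> and \<open>y\<close> becomes the closed segment joining the corresponding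
  vectors. Distinct closed edges meet at most in a common end point. The realization of a
  subgraph is a subset of that of the whole graph.\<close>

definition realization :: "'v::finite ugraph \<Rightarrow> (real ^ 'v) set" where
  "realization G =
     vertex_point ` verts G \<union> (\<Union>e\<in>edges G. convex hull (vertex_point ` e))"

abbreviation edge_path :: "'v::finite \<Rightarrow> 'v \<Rightarrow> real \<Rightarrow> real ^ 'v" where
  "edge_path x y \<equiv> linepath (vertex_point x) (vertex_point y)"

definition cycles :: "nat \<Rightarrow> 'v::finite ugraph \<Rightarrow> 'v ugraph set" where
  "cycles k G = {H. subgraph H G \<and> card (edges H) = k \<and>
                    realization H homeomorphic sphere (0 :: real ^ 2) 1}"

text \<open>\<open>D k\<close> is the \<open>k\<close>-th derivative on the closed interval, one-sided at the end points.\<close>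

definition smooth_on_interval ::
    "(real \<Rightarrow> 'a::real_normed_vector) \<Rightarrow> real \<Rightarrow> real \<Rightarrow> bool" where
  "smooth_on_interval g a b \<longleftrightarrow>
     (\<exists>D. D 0 = g \<and> (\<forall>k. \<forall>t\<in>{a..b}.
        (D k has_vector_derivative D (Suc k) t) (at t within {a..b})))"

text \<open>The finite set \<open>P\<close> is a subdivision of the unit interval; \<open>g\<close> is smooth on each closed
  interval between neighbouring points of \<open>P\<close>.\<close>

definition piecewise_smooth :: "(real \<Rightarrow> 'a::real_normed_vector) \<Rightarrow> bool" where
  "piecewise_smooth g \<longleftrightarrow> continuous_on {0..1} g \<and>
     (\<exists>P. finite P \<and> {0, 1} \<subseteq> P \<and> P \<subseteq> {0..1} \<and>
        (\<forall>a\<in>P. \<forall>b\<in>P. a < b \<and> P \<inter> {a<..<b} = {} \<longrightarrow> smooth_on_interval g a b))"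

definition locally_injective_on :: "'a::topological_space set \<Rightarrow> ('a \<Rightarrow> 'b) \<Rightarrow> bool" where
  "locally_injective_on X f \<longleftrightarrow> (\<forall>x\<in>X. \<exists>U. open U \<and> x \<in> U \<and> inj_on f (U \<inter> X))"

text \<open>Only the values of \<open>f\<close> on \<open>realization G\<close> matter here and below.\<close>

definition plane_immersion :: "'v::finite ugraph \<Rightarrow> (real ^ 'v \<Rightarrow> real ^ 2) \<Rightarrow> bool" where
  "plane_immersion G f \<longleftrightarrow>
     continuous_on (realization G) f \<and>
     locally_injective_on (realization G) f \<and>
     (\<forall>x y. {x, y} \<in> edges G \<longrightarrow> piecewise_smooth (f \<circ> edge_path x y))"

definition multiple_points :: "('a \<Rightarrow> 'b) \<Rightarrow> 'a set \<Rightarrow> 'b set" where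
  "multiple_points f X = {p. \<exists>a\<in>X. \<exists>b\<in>X. a \<noteq> b \<and> f a = p \<and> f b = p}"

text \<open>\<open>a\<close> is an interior point of an edge, and \<open>w\<close> is the velocity of \<open>f\<close> at \<open>a\<close> along that
  edge. The derivative is two-sided, so \<open>f\<close> has no corner at \<open>a\<close>.\<close>

definition edge_velocity ::
    "'v::finite ugraph \<Rightarrow> (real ^ 'v \<Rightarrow> real ^ 2) \<Rightarrow> real ^ 'v \<Rightarrow> real ^ 2 \<Rightarrow> bool" where
  "edge_velocity G f a w \<longleftrightarrow>
     (\<exists>x y t. {x, y} \<in> edges G \<and> 0 < t \<and> t < 1 \<and> a = edge_path x y t \<and>
        ((f \<circ> edge_path x y) has_vector_derivative w) (at t))"

definition transversal_double_point ::
    "'v::finite ugraph \<Rightarrow> (real ^ 'v \<Rightarrow> real ^ 2) \<Rightarrow> real ^ 2 \<Rightarrow> bool" where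
  "transversal_double_point G f p \<longleftrightarrow>
     (\<exists>a b w z. a \<noteq> b \<and> {q \<in> realization G. f q = p} = {a, b} \<and>
        edge_velocity G f a w \<and> edge_velocity G f b z \<and> span {w, z} = UNIV)"

definition plane_generic_immersion ::
    "'v::finite ugraph \<Rightarrow> (real ^ 'v \<Rightarrow> real ^ 2) \<Rightarrow> bool" where
  "plane_generic_immersion G f \<longleftrightarrow>
     plane_immersion G f \<and>
     finite (multiple_points f (realization G)) \<and>
     (\<forall>p\<in>multiple_points f (realization G). transversal_double_point G f p)"

text \<open>\<open>crossings f H\<close> is \<open>c(f(H))\<close>. It counts the crossings of the restriction of \<open>f\<close> to \<open>H\<close>,
  so both preimages of the double point must lie on \<open>H\<close>.\<close>

definition crossings :: "(real ^ 'v \<Rightarrow> real ^ 2) \<Rightarrow> 'v::finite ugraph \<Rightarrow> nat" where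
  "crossings f H = card (multiple_points f (realization H))"

text \<open>Addition in the numeral type \<open>5\<close> is addition modulo 5. \<open>Inl i\<close> is the vertex \<open>u\<^sub>i\<close> and
  \<open>Inr i\<close> is the vertex \<open>v\<^sub>i\<close>.\<close>

type_synonym petersen_vertex = "5 + 5"

definition petersen :: "petersen_vertex ugraph" where
  "petersen = \<lparr> verts = UNIV,
     edges = range (\<lambda>i. {Inl i, Inl (i + 1)}) \<union> range (\<lambda>i. {Inl i, Inr i})
           \<union> range (\<lambda>i. {Inr i, Inr (i + 2)}) \<rparr>"

end

theory Submission
  imports Defs "HOL-Complex_Analysis.Complex_Analysis"
begin

text \<open>Counting the \<open>k\<close>-cycles through two given edges, equal or not, reduces everything to one claim:
  the number of crossings between near edges (disjoint edges joined by a third one) is odd. The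
  number of 8-cycles through two edges is always a multiple of 4, and for \<open>k = 5, 6, 9\<close> the number
  is odd exactly for near edges.

  For two curves \<open>A\<close>, \<open>B\<close> the number of crossings has the parity of the winding number of
  \<open>A s - B t\<close> around the boundary of the unit square, which is a combination of the winding numbers
  of each curve around the end points of the other. A winding number of an edge around a vertex is
  a difference of two directions between vertices plus an integer. In the sum over all pairs of near
  edges the integers occur evenly often and the directions contribute a constant, which is the count
  for a drawing with straight edges and vertices in convex position.\<close>

section \<open>Winding numbers and crossing parity\<close>

text \<open>Self-crossings of an edge and crossings of adjacent edges can be created one at a time,
  so they carry no invariant; they drop out because an even number of the cycles in question passes
  through such a pair. Crossings of disjoint edges are better behaved but still change when an edge
  is pushed across a vertex: its crossings with the three edges there all change parity. An even
  number of these three is near the pushed edge, which is why near pairs are the right ones to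
  count. The proof does not deform \<open>f\<close> to a standard drawing. For disjoint edges the
  difference \<open>A s - B t\<close> has no zero on the boundary of the parameter square, and the
  pushes become integers inside its boundary winding number. As edges are open arcs, winding numbers
  around vertices are not integers and have to be split first. Cycles are given topologically. A
  circle has degree two at each of its vertices, hence belongs to the cycle space modulo 2, which is
  small enough to list; conversely the listed sets are shown to be circles by exhibiting closed
  walks.\<close>

lemma winding_number_scale:
  assumes "path p" "0 \<notin> path_image p" "c \<noteq> 0"
  shows "winding_number (\<lambda>t. c * p t) 0 = winding_number p 0"
proof -
  obtain q where q: "path q" "pathfinish q - pathstart q = 2 * of_real pi * \<i> * winding_number p 0"
    "\<And>t. t \<in> {0..1} \<Longrightarrow> p t = exp (q t)"
    using winding_number_as_continuous_log[OF assms(1,2)] by (metis add_0)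
  let ?r = "\<lambda>t. Ln c + q t"
  have "winding_number (\<lambda>t. c * p t) 0 = winding_number (exp \<circ> ?r) 0"
    by (rule winding_number_cong) (use q(3) assms(3) in \<open>auto simp: exp_add\<close>)
  also have "\<dots> = (pathfinish ?r - pathstart ?r) / (2 * of_real pi * \<i>)"
    using q(1) by (intro winding_number_compose_exp) (auto simp: path_def intro!: continuous_intros)
  also have "pathfinish ?r - pathstart ?r = 2 * of_real pi * \<i> * winding_number p 0"
    using q(2) by (simp add: pathfinish_def pathstart_def)
  finally show ?thesis by simp
qed

section \<open>Winding numbers along images of segments and rectangle boundaries\<close>

lemma subpath_linepath:
  "subpath u v (linepath a b) = linepath (linepath a b u) (linepath a b v)"
  by (auto simp: subpath_def linepath_def algebra_simps scaleR_left.add scaleR_left.diff)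

lemma winding_number_image_linepath_split:
  assumes "continuous_on (closed_segment a b) F" "z \<notin> F ` closed_segment a b"
    and "m \<in> closed_segment a b"
  shows "winding_number (F \<circ> linepath a b) z =
         winding_number (F \<circ> linepath a m) z + winding_number (F \<circ> linepath m b) z"
proof -
  obtain u where u: "u \<in> {0..1}" "m = linepath a b u"
    using assms(3) unfolding linepath_image_01[symmetric] by blast
  have sub: "subpath v w (F \<circ> linepath a b) = F \<circ> linepath (linepath a b v) (linepath a b w)" for v w
    using subpath_linepath[of v w a b] by (auto simp: subpath_def fun_eq_iff)
  have "path (F \<circ> linepath a b)"
    using assms(1) by (simp add: path_continuous_image)
  moreover have "z \<notin> path_image (F \<circ> linepath a b)"
    using assms(2) by (simp add: path_image_compose)
  ultimately have "winding_number (subpath 0 u (F \<circ> linepath a b)) z +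
      winding_number (subpath u 1 (F \<circ> linepath a b)) z = winding_number (subpath 0 1 (F \<circ> linepath a b)) z"
    using u(1) by (intro winding_number_subpath_combine) auto
  then show ?thesis
    unfolding sub u(2)[symmetric] by (simp add: linepath_0' linepath_1')
qed

lemma winding_number_image_linepath_reverse:
  assumes "continuous_on (closed_segment a b) F" "z \<notin> F ` closed_segment a b"
  shows "winding_number (F \<circ> linepath b a) z = - winding_number (F \<circ> linepath a b) z"
proof -
  have "F \<circ> linepath b a = reversepath (F \<circ> linepath a b)"
    by (auto simp: reversepath_def linepath_def fun_eq_iff algebra_simps)
  then show ?thesis
    using assms by (simp add: winding_number_reversepath path_continuous_image path_image_compose)
qed

lemma path_image_rectpath_segments:
  "path_image (rectpath a b) =
     closed_segment a (Complex (Re b) (Im a)) \<union> closed_segment (Complex (Re b) (Im a)) b \<union>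
     closed_segment b (Complex (Re a) (Im b)) \<union> closed_segment (Complex (Re a) (Im b)) a"
  by (simp add: rectpath_def Let_def path_image_join Un_assoc)

lemma winding_number_image_rectpath:
  fixes F :: "complex \<Rightarrow> complex"
  assumes "continuous_on (path_image (rectpath a b)) F" "z \<notin> F ` path_image (rectpath a b)"
  shows "winding_number (F \<circ> rectpath a b) z =
     winding_number (F \<circ> linepath a (Complex (Re b) (Im a))) z +
     winding_number (F \<circ> linepath (Complex (Re b) (Im a)) b) z +
     winding_number (F \<circ> linepath b (Complex (Re a) (Im b))) z +
     winding_number (F \<circ> linepath (Complex (Re a) (Im b)) a) z"
proof -
  have *: "path (F \<circ> linepath c d) \<and> z \<notin> path_image (F \<circ> linepath c d)"
    if "closed_segment c d \<subseteq> path_image (rectpath a b)" for c d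
    using that assms by (auto simp: path_image_compose intro!: path_continuous_image
        intro: continuous_on_subset)
  show ?thesis
    unfolding rectpath_def Let_def path_compose_join
    using *[of a "Complex (Re b) (Im a)"] *[of "Complex (Re b) (Im a)" b]
      *[of b "Complex (Re a) (Im b)"] *[of "Complex (Re a) (Im b)" a]
    by (simp add: path_image_rectpath_segments winding_number_join path_image_join
        pathstart_compose pathfinish_compose le_supI1 le_supI2)
qed

lemma path_image_rectpath_le:
  assumes "Re a \<le> Re b" "Im a \<le> Im b"
  shows "z \<in> path_image (rectpath a b) \<longleftrightarrow>
     z \<in> cbox a b \<and> (Re z = Re a \<or> Re z = Re b \<or> Im z = Im a \<or> Im z = Im b)"
  using assms by (auto simp: path_image_rectpath in_cbox_complex_iff)

text \<open>The vertical cut is a side of both pieces, traversed in opposite directions, so its two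
  contributions cancel; the horizontal sides are merely divided at \<open>c\<close>.\<close>

lemma winding_number_image_rectpath_split_Re:
  fixes F :: "complex \<Rightarrow> complex"
  assumes cont: "continuous_on (cbox a b) F" and le: "Im a \<le> Im b" and c: "Re a < c" "c < Re b"
    and nz: "z \<notin> F ` path_image (rectpath a b)"
    and nzc: "\<And>w. w \<in> cbox a b \<Longrightarrow> Re w = c \<Longrightarrow> F w \<noteq> z"
  shows "winding_number (F \<circ> rectpath a b) z =
     winding_number (F \<circ> rectpath a (Complex c (Im b))) z +
     winding_number (F \<circ> rectpath (Complex c (Im a)) b) z"
proof -
  let ?p = "Complex c (Im a)" and ?q = "Complex c (Im b)"
  let ?W = "\<lambda>x y. winding_number (F \<circ> linepath x y) z"
  have sub: "path_image (rectpath a b) \<subseteq> cbox a b"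
    "path_image (rectpath a ?q) \<subseteq> cbox a b" "path_image (rectpath ?p b) \<subseteq> cbox a b"
    using le c by (auto simp: path_image_rectpath in_cbox_complex_iff)
  have "F w \<noteq> z" if "w \<in> path_image (rectpath a ?q) \<union> path_image (rectpath ?p b)" for w
  proof -
    have "w \<in> path_image (rectpath a b) \<or> w \<in> cbox a b \<and> Re w = c"
      using that le c by (auto simp: path_image_rectpath_le in_cbox_complex_iff)
    then show ?thesis
      using nz nzc by blast
  qed
  then have nz': "z \<notin> F ` path_image (rectpath a ?q)" "z \<notin> F ` path_image (rectpath ?p b)"
    by auto
  have seg: "closed_segment a (Complex (Re b) (Im a)) \<subseteq> path_image (rectpath a b)"
    "closed_segment b (Complex (Re a) (Im b)) \<subseteq> path_image (rectpath a b)"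
    by (auto simp: path_image_rectpath_segments)
  have "?W a (Complex (Re b) (Im a)) = ?W a ?p + ?W ?p (Complex (Re b) (Im a))"
    using seg sub(1) nz c cont
    by (intro winding_number_image_linepath_split) (auto simp: closed_segment_same_Im closed_segment_eq_real_ivl
        intro: continuous_on_subset)
  moreover have "?W b (Complex (Re a) (Im b)) = ?W b ?q + ?W ?q (Complex (Re a) (Im b))"
    using seg sub(1) nz c cont
    by (intro winding_number_image_linepath_split) (auto simp: closed_segment_same_Im closed_segment_eq_real_ivl
        intro: continuous_on_subset)
  moreover have "?W ?q ?p = - ?W ?p ?q"
    using sub(2) nz' cont
    by (intro winding_number_image_linepath_reverse)
       (auto simp: path_image_rectpath_segments intro: continuous_on_subset)
  ultimately show ?thesis
    using sub cont nz nz' by (simp add: winding_number_image_rectpath continuous_on_subset)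
qed

lemma winding_number_image_rectpath_split_Im:
  fixes F :: "complex \<Rightarrow> complex"
  assumes cont: "continuous_on (cbox a b) F" and le: "Re a \<le> Re b" and c: "Im a < c" "c < Im b"
    and nz: "z \<notin> F ` path_image (rectpath a b)"
    and nzc: "\<And>w. w \<in> cbox a b \<Longrightarrow> Im w = c \<Longrightarrow> F w \<noteq> z"
  shows "winding_number (F \<circ> rectpath a b) z =
     winding_number (F \<circ> rectpath a (Complex (Re b) c)) z +
     winding_number (F \<circ> rectpath (Complex (Re a) c) b) z"
proof -
  let ?p = "Complex (Re a) c" and ?q = "Complex (Re b) c"
  let ?W = "\<lambda>x y. winding_number (F \<circ> linepath x y) z"
  have sub: "path_image (rectpath a b) \<subseteq> cbox a b"
    "path_image (rectpath a ?q) \<subseteq> cbox a b" "path_image (rectpath ?p b) \<subseteq> cbox a b"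
    using le c by (auto simp: path_image_rectpath in_cbox_complex_iff)
  have "F w \<noteq> z" if "w \<in> path_image (rectpath a ?q) \<union> path_image (rectpath ?p b)" for w
  proof -
    have "w \<in> path_image (rectpath a b) \<or> w \<in> cbox a b \<and> Im w = c"
      using that le c by (auto simp: path_image_rectpath_le in_cbox_complex_iff)
    then show ?thesis
      using nz nzc by blast
  qed
  then have nz': "z \<notin> F ` path_image (rectpath a ?q)" "z \<notin> F ` path_image (rectpath ?p b)"
    by auto
  have seg: "closed_segment (Complex (Re b) (Im a)) b \<subseteq> path_image (rectpath a b)"
    "closed_segment (Complex (Re a) (Im b)) a \<subseteq> path_image (rectpath a b)"
    by (auto simp: path_image_rectpath_segments)
  have "?W (Complex (Re b) (Im a)) b = ?W (Complex (Re b) (Im a)) ?q + ?W ?q b"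
    using seg sub(1) nz c cont
    by (intro winding_number_image_linepath_split) (auto simp: closed_segment_same_Re closed_segment_eq_real_ivl
        intro: continuous_on_subset)
  moreover have "?W (Complex (Re a) (Im b)) a = ?W (Complex (Re a) (Im b)) ?p + ?W ?p a"
    using seg sub(1) nz c cont
    by (intro winding_number_image_linepath_split) (auto simp: closed_segment_same_Re closed_segment_eq_real_ivl
        intro: continuous_on_subset)
  moreover have "?W ?q ?p = - ?W ?p ?q"
    using sub(3) nz' cont
    by (intro winding_number_image_linepath_reverse)
       (auto simp: path_image_rectpath_segments intro: continuous_on_subset)
  ultimately show ?thesis
    using sub cont nz nz' by (simp add: winding_number_image_rectpath continuous_on_subset)
qed

text \<open>The rectangle is convex, so its boundary contracts inside it to the corner
  \<open>a\<close>, and \<open>F\<close> carries this contraction into the complement of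
  \<open>z\<close>.\<close>

lemma winding_number_image_rectpath_zero:
  fixes F :: "complex \<Rightarrow> complex"
  assumes cont: "continuous_on (cbox a b) F" and nz: "z \<notin> F ` cbox a b"
    and le: "Re a \<le> Re b" "Im a \<le> Im b"
  shows "winding_number (F \<circ> rectpath a b) z = 0"
proof -
  have sub: "path_image (rectpath a b) \<subseteq> cbox a b"
    by (rule path_image_rectpath_subset_cbox[OF le])
  have a: "a \<in> cbox a b"
    using le by (simp add: in_cbox_complex_iff)
  have "homotopic_loops (cbox a b) (rectpath a b) (linepath a a)"
  proof (rule homotopic_loops_linear)
    fix t :: real assume "t \<in> {0..1}"
    then have "rectpath a b t \<in> cbox a b"
      using sub by (auto simp: path_image_def)
    then show "closed_segment (rectpath a b t) (linepath a a t) \<subseteq> cbox a b"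
      using a by (intro closed_segment_subset convex_box) (auto simp: linepath_refl)
  qed auto
  then have "homotopic_loops (- {z}) (F \<circ> rectpath a b) (F \<circ> linepath a a)"
    using cont nz by (intro homotopic_loops_continuous_image[where S = "cbox a b"]) auto
  then have "winding_number (F \<circ> rectpath a b) z = winding_number (F \<circ> linepath a a) z"
    by (rule winding_number_homotopic_loops)
  also have "F \<circ> linepath a a = linepath (F a) (F a)"
    by (auto simp: linepath_refl)
  also have "winding_number \<dots> z = 0"
    using nz a by (intro winding_number_trivial) auto
  finally show ?thesis .
qed

text \<open>The real linear map x + iy to x + cy is invertible for every non-real \<open>c\<close>.
  Each open half plane is convex, so \<open>c\<close> can be moved along a segment to \<i> or -\<i>
  without creating a zero; there the map is the identity or the conjugation.\<close>

lemma winding_number_shear_rectpath: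
  fixes c :: complex
  assumes "p \<in> box a b" "Im c \<noteq> 0"
  shows "winding_number (\<lambda>t. of_real (Re (rectpath a b t - p)) + c * of_real (Im (rectpath a b t - p))) 0 \<in> {1, -1}"
proof -
  let ?r = "rectpath a b"
  let ?h = "\<lambda>c t. complex_of_real (Re (?r t - p)) + c * of_real (Im (?r t - p))"
  have rp: "?r t \<noteq> p" if "t \<in> {0..1}" for t
    using that assms(1) path_image_rectpath_cbox_minus_box[of a b]
    by (auto simp: path_image_def in_box_complex_iff)
  have path: "path (?h c)" for c
    using path_rectpath[of a b] unfolding path_def by (intro continuous_intros)
  have loop: "pathfinish (?h c) = pathstart (?h c)" for c
    using pathfinish_rectpath[of a b] pathstart_rectpath[of a b]
    by (simp add: pathfinish_def pathstart_def)
  have base: "winding_number (\<lambda>t. ?r t - p) 0 = 1"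
    using winding_number_rectpath[OF assms(1)] by (simp add: winding_number_offset[of _ p])
  have homotopic: "winding_number (?h c) 0 = winding_number (?h d) 0" if "Im c * Im d > 0" for c d
  proof (rule winding_number_loops_linear_eq[OF path path loop loop])
    fix t :: real assume t: "t \<in> {0..1}"
    show "0 \<notin> closed_segment (?h d t) (?h c t)"
    proof
      assume "0 \<in> closed_segment (?h d t) (?h c t)"
      then obtain u where u: "0 \<le> u" "u \<le> 1" "0 = (1 - u) *\<^sub>R ?h d t + u *\<^sub>R ?h c t"
        by (auto simp: in_segment)
      define x y where "x = Re (?r t - p)" and "y = Im (?r t - p)"
      have im: "((1 - u) * Im d + u * Im c) * y = 0"
        using arg_cong[OF u(3), of Im] by (simp add: x_def y_def algebra_simps)
      have "(1 - u) * Im d + u * Im c \<noteq> 0"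
      proof (cases "Im d > 0")
        case True
        then have "Im c > 0" using that by (simp add: zero_less_mult_iff)
        then have "(1 - u) * Im d + u * Im c > 0"
          using True u by (cases "u = 0") (auto intro!: add_nonneg_pos)
        then show ?thesis by simp
      next
        case False
        then have *: "Im c < 0" "Im d < 0" using that by (auto simp: zero_less_mult_iff)
        have "(1 - u) * Im d + u * Im c < 0"
          using * u by (cases "u = 0") (auto intro!: add_nonpos_neg simp: mult_nonneg_nonpos mult_pos_neg)
        then show ?thesis by simp
      qed
      with im have y: "y = 0" by simp
      have "0 = (1 - u) * x + u * x"
        using arg_cong[OF u(3), of Re] y by (simp add: x_def y_def)
      then have "x = 0" by (simp add: algebra_simps)
      with y have "?r t = p" by (simp add: x_def y_def complex_eq_iff)
      with rp[OF t] show False by simp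
    qed
  qed
  show ?thesis
  proof (cases "Im c > 0")
    case True
    have "?h \<i> = (\<lambda>t. ?r t - p)"
      by (auto simp: complex_eq_iff)
    with homotopic[of c \<i>] True base show ?thesis by simp
  next
    case False
    have "?h (- \<i>) = cnj \<circ> (\<lambda>t. ?r t - p)"
      by (auto simp: complex_eq_iff)
    moreover have "winding_number (cnj \<circ> (\<lambda>t. ?r t - p)) (cnj 0) = - cnj (winding_number (\<lambda>t. ?r t - p) 0)"
    proof (rule winding_number_cnj)
      show "path (\<lambda>t. ?r t - p)"
        using path_rectpath[of a b] unfolding path_def by (intro continuous_intros)
      show "0 \<notin> path_image (\<lambda>t. ?r t - p)"
        using rp by (auto simp: path_image_def)
    qed
    ultimately show ?thesis
      using homotopic[of c "-\<i>"] False base assms(2) by simp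
  qed
qed


text \<open>\<open>Im (cnj \<alpha> * \<beta>)\<close> is the determinant of the derivative at
  \<open>p\<close>. The boundary is shrunk towards \<open>p\<close> until \<open>F\<close> is
  dominated by its derivative; dividing by \<alpha> then leaves the map of
  \<open>winding_number_shear_rectpath\<close>.\<close>

lemma winding_number_image_rectpath_simple_zero:
  fixes F :: "complex \<Rightarrow> complex" and \<alpha> \<beta> :: complex
  assumes cont: "continuous_on (cbox a b) F" and p: "p \<in> box a b" "F p = 0"
    and nz: "\<And>w. w \<in> cbox a b \<Longrightarrow> w \<noteq> p \<Longrightarrow> F w \<noteq> 0"
    and der: "(F has_derivative (\<lambda>h. \<alpha> * of_real (Re h) + \<beta> * of_real (Im h))) (at p)"
    and indep: "Im (cnj \<alpha> * \<beta>) \<noteq> 0"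
  shows "winding_number (F \<circ> rectpath a b) 0 \<in> {1, -1}"
proof -
  let ?r = "rectpath a b"
  define c where "c = \<beta> / \<alpha>"
  have \<alpha>: "\<alpha> \<noteq> 0" using indep by auto
  have c: "Im c \<noteq> 0"
    using indep \<alpha> by (auto simp: c_def Im_divide algebra_simps)
  define L where "L = (\<lambda>h. \<alpha> * (of_real (Re h) + c * of_real (Im h)))"
  have L: "L = (\<lambda>h. \<alpha> * of_real (Re h) + \<beta> * of_real (Im h))"
    using \<alpha> by (auto simp: L_def c_def field_simps)
  have "linear L"
    using has_derivative_linear[OF der] unfolding L .
  have L0: "h = 0" if "L h = 0" for h
  proof -
    have "of_real (Re h) + c * of_real (Im h) = 0"
      using that \<alpha> by (simp add: L_def)
    then have "Im h = 0" "Re h = 0"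
      using c by (auto simp: complex_eq_iff)
    then show "h = 0"
      by (simp add: complex_eq_iff)
  qed
  then have "inj L"
    using linear_injective_0[OF \<open>linear L\<close>] by blast
  then obtain m where m: "m > 0" "\<And>h. norm (L h) \<ge> m * norm h"
    using linear_inj_bounded_below_pos[OF \<open>linear L\<close>] by (metis mult.commute)
  \<comment> \<open>Half of the lower bound \<open>m\<close> keeps the error strictly below the norm
    of \<open>L\<close>, as \<open>winding_number_nearby_loops_eq\<close> requires.\<close>
  obtain d where d: "d > 0"
    "\<And>y. norm (y - p) < d \<Longrightarrow> norm (F y - F p - L (y - p)) \<le> m / 2 * norm (y - p)"
    using der m(1) unfolding L[symmetric] has_derivative_at_alt by (meson half_gt_zero)
  have in_box: "?r t \<in> cbox a b" "?r t \<noteq> p" if "t \<in> {0..1}" for t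
    using that p(1) path_image_rectpath_cbox_minus_box[of a b]
    by (auto simp: path_image_def in_box_complex_iff)
  have pc: "p \<in> cbox a b" using p(1) box_subset_cbox by blast
  obtain K where K: "K > 0" "\<And>w. w \<in> cbox a b \<Longrightarrow> norm (w - p) \<le> K"
    using bounded_translation_minus[OF bounded_cbox[of a b], of p] unfolding bounded_pos by blast
  \<comment> \<open>The shrinking factor: at most 1, so that the shrunk boundary stays in the
    rectangle; the 2 makes \<open>u * K < d\<close> strict.\<close>
  define u where "u = min 1 (d / (2 * K))"
  have u: "0 < u" "u \<le> 1" "u * K < d"
    using d(1) K(1) by (auto simp: u_def min_def field_simps)
  let ?s = "\<lambda>t. p + u *\<^sub>R (?r t - p)"
  have path_r: "path (\<lambda>t. ?s t)" "path (\<lambda>t. of_real (Re (?r t - p)) + c * of_real (Im (?r t - p)))"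
    using path_rectpath[of a b] unfolding path_def by (auto intro!: continuous_intros)
  have loop_s: "pathfinish ?s = pathstart ?s"
    using pathfinish_rectpath[of a b] pathstart_rectpath[of a b]
    by (simp add: pathfinish_def pathstart_def)
  have "homotopic_loops (cbox a b - {p}) ?r ?s"
  proof (rule homotopic_loops_linear)
    fix t :: real assume t: "t \<in> {0..1}"
    show "closed_segment (?r t) (?s t) \<subseteq> cbox a b - {p}"
    proof
      fix w assume "w \<in> closed_segment (?r t) (?s t)"
      then obtain v where v: "0 \<le> v" "v \<le> 1" "w = (1 - v) *\<^sub>R ?r t + v *\<^sub>R ?s t"
        by (auto simp: in_segment)
      define k where "k = 1 - v + v * u"
      have w: "w = (1 - k) *\<^sub>R p + k *\<^sub>R ?r t"
        unfolding v(3) k_def by (simp add: algebra_simps)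
      have "k \<le> 1"
        using u v by (simp add: k_def mult_left_le)
      moreover have "k > 0"
        using u v by (cases "v = 1") (auto simp: k_def intro!: add_pos_nonneg)
      ultimately have "w \<in> cbox a b"
        unfolding w using pc in_box(1)[OF t] by (intro convexD convex_box) auto
      moreover have "w - p = k *\<^sub>R (?r t - p)"
        unfolding w by (simp add: algebra_simps)
      then have "w \<noteq> p"
        using in_box(2)[OF t] \<open>k > 0\<close> by auto
      ultimately show "w \<in> cbox a b - {p}" by simp
    qed
  qed (use path_r loop_s in auto)
  moreover have "continuous_on (cbox a b - {p}) F"
    using cont continuous_on_subset by blast
  ultimately have "homotopic_loops (- {0}) (F \<circ> ?r) (F \<circ> ?s)"
    using nz by (intro homotopic_loops_continuous_image) auto
  note hom = this
  have "winding_number (F \<circ> ?r) 0 = winding_number (F \<circ> ?s) 0"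
    by (rule winding_number_homotopic_loops[OF hom])
  also have "\<dots> = winding_number (\<lambda>t. L (u *\<^sub>R (?r t - p))) 0"
  proof (rule winding_number_nearby_loops_eq)
    show "path (\<lambda>t. L (u *\<^sub>R (?r t - p)))"
      using path_rectpath[of a b] unfolding path_def L_def by (auto intro!: continuous_intros)
    show "path (F \<circ> ?s)"
      using homotopic_loops_imp_path[OF hom] by simp
    show "pathfinish (\<lambda>t. L (u *\<^sub>R (?r t - p))) = pathstart (\<lambda>t. L (u *\<^sub>R (?r t - p)))"
      using pathfinish_rectpath[of a b] pathstart_rectpath[of a b]
      by (simp add: pathfinish_def pathstart_def)
    show "pathfinish (F \<circ> ?s) = pathstart (F \<circ> ?s)"
      using loop_s by (simp add: pathfinish_compose pathstart_compose)
    fix t :: real assume t: "t \<in> {0..1}"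
    let ?y = "u *\<^sub>R (?r t - p)"
    have "u * norm (?r t - p) \<le> u * K"
      using K(2)[OF in_box(1)[OF t]] u(1) by (intro mult_left_mono) auto
    then have "u * norm (?r t - p) < d"
      using u(3) by (rule le_less_trans)
    then have "norm ?y < d"
      using u(1) by simp
    then have "norm (F (?s t) - L ?y) \<le> m / 2 * norm ?y"
      using d(2)[of "?s t"] p(2) by simp
    also have "\<dots> < m * norm ?y"
      using m(1) u(1) in_box(2)[OF t] by simp
    also have "\<dots> \<le> norm (L ?y)" by (rule m(2))
    finally show "norm ((F \<circ> ?s) t - L ?y) < norm (L ?y - 0)" by simp
  qed
  also have "(\<lambda>t. L (u *\<^sub>R (?r t - p))) = (\<lambda>t. (\<alpha> * of_real u) * (of_real (Re (?r t - p)) + c * of_real (Im (?r t - p))))"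
    by (auto simp: L_def algebra_simps)
  also have "winding_number \<dots> 0 = winding_number (\<lambda>t. of_real (Re (?r t - p)) + c * of_real (Im (?r t - p))) 0"
  proof (rule winding_number_scale)
    show "0 \<notin> path_image (\<lambda>t. of_real (Re (?r t - p)) + c * of_real (Im (?r t - p)))"
    proof
      assume "0 \<in> path_image (\<lambda>t. of_real (Re (?r t - p)) + c * of_real (Im (?r t - p)))"
      then obtain t where t: "t \<in> {0..1}" "0 = of_real (Re (?r t - p)) + c * of_real (Im (?r t - p))"
        by (auto simp: path_image_def)
      then have "L (?r t - p) = 0" by (metis L_def mult_zero_right)
      then show False using L0 in_box(2)[OF t(1)] by fastforce
    qed
  qed (use path_r u \<alpha> in auto)
  finally have "winding_number (F \<circ> ?r) 0 = winding_number (\<lambda>t. of_real (Re (?r t - p)) + c * of_real (Im (?r t - p))) 0" .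
  then show ?thesis
    using winding_number_shear_rectpath[OF p(1) c] by (simp only:)
qed

section \<open>Counting simple zeros in a rectangle modulo 2\<close>

lemma exists_between_avoiding:
  fixes x y :: real
  assumes "x < y" "finite S"
  obtains c where "x < c" "c < y" "c \<notin> S"
  using assms by (metis finite_subset greaterThanLessThan_iff infinite_Ioo subsetI)

text \<open>Two distinct zeros differ in their real or imaginary parts, so a line parallel to a side
  and free of zeros separates them. Both pieces then contain a zero, hence fewer zeros than the
  whole. A single zero contributes 1 or -1, which is odd.\<close>

theorem winding_number_image_rectpath_parity:
  fixes F :: "complex \<Rightarrow> complex"
  assumes "continuous_on (cbox a b) F" and "Re a \<le> Re b" "Im a \<le> Im b"
    and "finite {w \<in> cbox a b. F w = 0}" "{w \<in> cbox a b. F w = 0} \<subseteq> box a b"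
    and "\<And>p. p \<in> cbox a b \<Longrightarrow> F p = 0 \<Longrightarrow> \<exists>\<alpha> \<beta> :: complex. Im (cnj \<alpha> * \<beta>) \<noteq> 0 \<and>
           (F has_derivative (\<lambda>h. \<alpha> * of_real (Re h) + \<beta> * of_real (Im h))) (at p)"
  shows "\<exists>n::int. winding_number (F \<circ> rectpath a b) 0 = of_int n \<and>
           (even n \<longleftrightarrow> even (card {w \<in> cbox a b. F w = 0}))"
  using assms
proof (induction "card {w \<in> cbox a b. F w = 0}" arbitrary: a b rule: less_induct)
  case less
  define Z where "Z a b = {w \<in> cbox a b. F w = 0}" for a b
  note prems = less.prems[folded Z_def]
  let ?P = "\<lambda>a b. \<exists>n::int. winding_number (F \<circ> rectpath a b) 0 = of_int n \<and> (even n \<longleftrightarrow> even (card (Z a b)))"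
  \<comment> \<open>Both kinds of cut produce a piece with corners \<open>a\<close>,
    \<open>q'\<close> and a piece with corners \<open>q\<close>, \<open>b\<close>, so one gluing
    argument serves for them.\<close>
  have glue: "?P a b"
    if q: "q \<in> cbox a b" "Re a \<le> Re q'" "Im a \<le> Im q'" and q': "q' \<in> cbox a b" "Re q \<le> Re b" "Im q \<le> Im b"
      and wn: "winding_number (F \<circ> rectpath a b) 0 =
        winding_number (F \<circ> rectpath a q') 0 + winding_number (F \<circ> rectpath q b) 0"
      and ZZ: "Z a b = Z a q' \<union> Z q b" "Z a q' \<inter> Z q b = {}" "Z a q' \<noteq> {}" "Z q b \<noteq> {}"
      and bx: "Z a q' \<subseteq> box a q'" "Z q b \<subseteq> box q b" for q q'
  proof -
    have sub: "cbox a q' \<subseteq> cbox a b" "cbox q b \<subseteq> cbox a b"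
      using q q' by (auto simp: in_cbox_complex_iff)
    have card: "card (Z a b) = card (Z a q') + card (Z q b)"
      using ZZ(1,2) prems(4) by (metis card_Un_disjoint finite_Un)
    have fin: "finite (Z a q')" "finite (Z q b)"
      using ZZ(1) prems(4) by auto
    then have pos: "card (Z a q') > 0" "card (Z q b) > 0"
      using ZZ(3,4) by (auto simp: card_gt_0_iff)
    have "?P a q'"
      by (rule less.hyps[folded Z_def])
         (use sub card pos fin bx(1) q prems continuous_on_subset in \<open>auto simp: subset_iff\<close>)
    moreover have "?P q b"
      by (rule less.hyps[folded Z_def])
         (use sub card pos fin bx(2) q' prems continuous_on_subset in \<open>auto simp: subset_iff\<close>)
    ultimately obtain m n :: int where
      "winding_number (F \<circ> rectpath a q') 0 = of_int m" "even m \<longleftrightarrow> even (card (Z a q'))"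
      "winding_number (F \<circ> rectpath q b) 0 = of_int n" "even n \<longleftrightarrow> even (card (Z q b))"
      by blast
    then show ?thesis
      by (intro exI[of _ "m + n"]) (auto simp: wn card)
  qed
  have nzb: "0 \<notin> F ` path_image (rectpath a b)"
    using prems(5) by (force simp: Z_def path_image_rectpath_cbox_minus_box[OF prems(2,3)])
  have split_Re: "?P a b" if pq: "p \<in> Z a b" "q \<in> Z a b" "Re p < Re q" for p q
  proof -
    obtain c where c: "Re p < c" "c < Re q" "c \<notin> Re ` Z a b"
      using exists_between_avoiding pq(3) prems(4) by (metis finite_imageI)
    have bx: "p \<in> box a b" "q \<in> box a b" using pq prems(5) by auto
    then have less: "Re a < c" "c < Re b" "Im a < Im b"
      using c by (auto simp: in_box_complex_iff)
    have Zc: "Re w \<noteq> c" if "w \<in> Z a b" for w using c(3) that by auto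
    let ?q' = "Complex c (Im b)" and ?q = "Complex c (Im a)"
    have mem: "w \<in> Z a ?q' \<longleftrightarrow> w \<in> Z a b \<and> Re w < c" "w \<in> Z ?q b \<longleftrightarrow> w \<in> Z a b \<and> Re w > c" for w
      using Zc[of w] less by (auto simp: Z_def in_cbox_complex_iff)
    have "Z a ?q' \<subseteq> box a ?q'" "Z ?q b \<subseteq> box ?q b"
      using prems(5) unfolding subset_iff mem by (auto simp: in_box_complex_iff)
    moreover have "Z a b = Z a ?q' \<union> Z ?q b" "Z a ?q' \<inter> Z ?q b = {}"
      using Zc unfolding set_eq_iff Un_iff Int_iff mem by (auto simp: neq_iff)
    moreover have "Z a ?q' \<noteq> {}" "Z ?q b \<noteq> {}"
      using mem[of p] mem[of q] pq c by auto
    moreover have "winding_number (F \<circ> rectpath a b) 0 =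
        winding_number (F \<circ> rectpath a ?q') 0 + winding_number (F \<circ> rectpath ?q b) 0"
      by (rule winding_number_image_rectpath_split_Re) (use prems less nzb Zc in \<open>auto simp: Z_def\<close>)
    ultimately show ?thesis
      using less by (intro glue) (auto simp: in_cbox_complex_iff)
  qed
  have split_Im: "?P a b" if pq: "p \<in> Z a b" "q \<in> Z a b" "Im p < Im q" for p q
  proof -
    obtain c where c: "Im p < c" "c < Im q" "c \<notin> Im ` Z a b"
      using exists_between_avoiding pq(3) prems(4) by (metis finite_imageI)
    have bx: "p \<in> box a b" "q \<in> box a b" using pq prems(5) by auto
    then have less: "Im a < c" "c < Im b" "Re a < Re b"
      using c by (auto simp: in_box_complex_iff)
    have Zc: "Im w \<noteq> c" if "w \<in> Z a b" for w using c(3) that by auto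
    let ?q' = "Complex (Re b) c" and ?q = "Complex (Re a) c"
    have mem: "w \<in> Z a ?q' \<longleftrightarrow> w \<in> Z a b \<and> Im w < c" "w \<in> Z ?q b \<longleftrightarrow> w \<in> Z a b \<and> Im w > c" for w
      using Zc[of w] less by (auto simp: Z_def in_cbox_complex_iff)
    have "Z a ?q' \<subseteq> box a ?q'" "Z ?q b \<subseteq> box ?q b"
      using prems(5) unfolding subset_iff mem by (auto simp: in_box_complex_iff)
    moreover have "Z a b = Z a ?q' \<union> Z ?q b" "Z a ?q' \<inter> Z ?q b = {}"
      using Zc unfolding set_eq_iff Un_iff Int_iff mem by (auto simp: neq_iff)
    moreover have "Z a ?q' \<noteq> {}" "Z ?q b \<noteq> {}"
      using mem[of p] mem[of q] pq c by auto
    moreover have "winding_number (F \<circ> rectpath a b) 0 =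
        winding_number (F \<circ> rectpath a ?q') 0 + winding_number (F \<circ> rectpath ?q b) 0"
      by (rule winding_number_image_rectpath_split_Im) (use prems less nzb Zc in \<open>auto simp: Z_def\<close>)
    ultimately show ?thesis
      using less by (intro glue) (auto simp: in_cbox_complex_iff)
  qed
  have "?P a b"
  proof (cases "\<exists>p\<in>Z a b. \<exists>q\<in>Z a b. p \<noteq> q")
    case True
    then obtain p q where "p \<in> Z a b" "q \<in> Z a b" "Re p < Re q \<or> Im p < Im q"
      by (metis complex_eq_iff linorder_neqE_linordered_idom)
    then show ?thesis using split_Re split_Im by blast
  next
    case False
    show ?thesis
    proof (cases "Z a b = {}")
      case True
      then have "winding_number (F \<circ> rectpath a b) 0 = 0"
        using prems by (intro winding_number_image_rectpath_zero) (auto simp: Z_def)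
      then show ?thesis using True by (intro exI[of _ 0]) auto
    next
      case ne: False
      then obtain p where p: "Z a b = {p}" using False by blast
      then have "p \<in> cbox a b" "F p = 0" by (auto simp: Z_def)
      then obtain \<alpha> \<beta> where "Im (cnj \<alpha> * \<beta>) \<noteq> 0"
        "(F has_derivative (\<lambda>h. \<alpha> * of_real (Re h) + \<beta> * of_real (Im h))) (at p)"
        using prems(6) by blast
      then have "winding_number (F \<circ> rectpath a b) 0 \<in> {1, -1}"
        using p prems by (intro winding_number_image_rectpath_simple_zero) (auto simp: Z_def)
      then show ?thesis using p
        by (auto intro: exI[of _ 1] exI[of _ "-1"])
    qed
  qed
  then show ?case by (simp only: Z_def)
qed


text \<open>The four winding numbers are those of \<open>A s - B t\<close> along the sides of the
  unit square; the two negative ones belong to the sides that are traversed backwards. That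
  \<open>Z\<close> lies in the open square says that neither curve passes through an end point of
  the other, so no side meets zero.\<close>

theorem crossing_parity:
  fixes A B :: "real \<Rightarrow> complex"
  defines "Z \<equiv> {(s, t). s \<in> {0..1} \<and> t \<in> {0..1} \<and> A s = B t}"
  assumes cont: "continuous_on {0..1} A" "continuous_on {0..1} B"
    and fin: "finite Z" and inner: "Z \<subseteq> {0<..<1} \<times> {0<..<1}"
    and der: "\<And>s t. (s, t) \<in> Z \<Longrightarrow> \<exists>\<alpha> \<beta>. (A has_vector_derivative \<alpha>) (at s) \<and>
      (B has_vector_derivative \<beta>) (at t) \<and> Im (cnj \<alpha> * \<beta>) \<noteq> 0"
  shows "\<exists>n::int. winding_number A (B 0) + winding_number B (A 1)
            - winding_number A (B 1) - winding_number B (A 0) = of_int n \<and>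
           (even n \<longleftrightarrow> even (card Z))"
proof -
  \<comment> \<open>The parameter square is placed in the complex plane, with \<open>s\<close> as
    real and \<open>t\<close> as imaginary part, to make \<open>rectpath\<close> its
    boundary.\<close>
  define F where "F = (\<lambda>z. A (Re z) - B (Im z))"
  let ?b = "Complex 1 1"
  have cont_F: "continuous_on (cbox 0 ?b) F"
    unfolding F_def
    by (intro continuous_intros continuous_on_compose2[OF cont(1)] continuous_on_compose2[OF cont(2)])
       (auto simp: in_cbox_complex_iff)
  have zeros: "{w \<in> cbox 0 ?b. F w = 0} = (\<lambda>(s, t). Complex s t) ` Z"
    unfolding set_eq_iff
  proof
    fix w
    show "w \<in> {w \<in> cbox 0 ?b. F w = 0} \<longleftrightarrow> w \<in> (\<lambda>(s, t). Complex s t) ` Z"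
      by (cases w) (auto simp: F_def Z_def in_cbox_complex_iff)
  qed
  have card: "card {w \<in> cbox 0 ?b. F w = 0} = card Z"
    unfolding zeros by (intro card_image) (auto simp: inj_on_def)
  have par: "\<exists>n::int. winding_number (F \<circ> rectpath 0 ?b) 0 = of_int n \<and>
      (even n \<longleftrightarrow> even (card {w \<in> cbox 0 ?b. F w = 0}))"
  proof (rule winding_number_image_rectpath_parity)
    show "finite {w \<in> cbox 0 ?b. F w = 0}" using fin by (simp add: zeros)
    show "{w \<in> cbox 0 ?b. F w = 0} \<subseteq> box 0 ?b"
      using inner by (auto simp: zeros in_box_complex_iff)
    fix p assume p: "p \<in> cbox 0 ?b" "F p = 0"
    then have "(Re p, Im p) \<in> Z" by (auto simp: Z_def F_def in_cbox_complex_iff)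
    then obtain \<alpha> \<beta> where d: "(A has_vector_derivative \<alpha>) (at (Re p))"
      "(B has_vector_derivative \<beta>) (at (Im p))" "Im (cnj \<alpha> * \<beta>) \<noteq> 0"
      using der by blast
    have re: "(Re has_derivative Re) (at p)" and im: "(Im has_derivative Im) (at p)"
      by (auto intro!: derivative_eq_intros)
    have "((\<lambda>z. A (Re z)) has_derivative (\<lambda>h. Re h *\<^sub>R \<alpha>)) (at p)"
      using has_derivative_compose[OF re d(1)[unfolded has_vector_derivative_def]] .
    moreover have "((\<lambda>z. B (Im z)) has_derivative (\<lambda>h. Im h *\<^sub>R \<beta>)) (at p)"
      using has_derivative_compose[OF im d(2)[unfolded has_vector_derivative_def]] .
    ultimately have "(F has_derivative (\<lambda>h. Re h *\<^sub>R \<alpha> - Im h *\<^sub>R \<beta>)) (at p)"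
      unfolding F_def by (rule has_derivative_diff)
    moreover have "(\<lambda>h. Re h *\<^sub>R \<alpha> - Im h *\<^sub>R \<beta>) =
        (\<lambda>h. \<alpha> * of_real (Re h) + (- \<beta>) * of_real (Im h))"
      by (auto simp: scaleR_conv_of_real algebra_simps)
    moreover have "Im (cnj \<alpha> * - \<beta>) \<noteq> 0" using d(3) by simp
    ultimately show "\<exists>\<alpha> \<beta>::complex. Im (cnj \<alpha> * \<beta>) \<noteq> 0 \<and>
        (F has_derivative (\<lambda>h. \<alpha> * of_real (Re h) + \<beta> * of_real (Im h))) (at p)"
      by metis
  qed (use cont_F in auto)
  have side: "F z \<noteq> 0" if "z \<in> path_image (rectpath 0 ?b)" for z
  proof
    assume "F z = 0"
    moreover have "z \<in> cbox 0 ?b" using that by (subst (asm) path_image_rectpath_le) auto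
    ultimately have "z \<in> box 0 ?b" using zeros inner by (fastforce simp: in_box_complex_iff)
    then show False using that by (subst (asm) path_image_rectpath_cbox_minus_box) auto
  qed
  have sub: "path_image (rectpath 0 ?b) \<subseteq> cbox 0 ?b"
    by (rule path_image_rectpath_subset_cbox) auto
  \<comment> \<open>On the vertical sides the difference has the wrong sign for a winding number of
    \<open>B\<close>; the factor -1 does not change it.\<close>
  have neg: "winding_number (\<lambda>t. A x - B t) 0 = winding_number B (A x)" if x: "x \<in> {0, 1}" for x
  proof -
    have "B t \<noteq> A x" if "t \<in> {0..1}" for t
      using side[of "Complex x t"] x that by (auto simp: F_def path_image_rectpath_le in_cbox_complex_iff)
    then have "winding_number (\<lambda>t. - 1 * (B t - A x)) 0 = winding_number (\<lambda>t. B t - A x) 0"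
      using cont(2) by (intro winding_number_scale) (auto simp: path_def path_image_def intro!: continuous_intros)
    then show ?thesis by (simp add: winding_number_offset[of B])
  qed
  have segs: "closed_segment \<i> ?b \<subseteq> path_image (rectpath 0 ?b)"
    "closed_segment 0 \<i> \<subseteq> path_image (rectpath 0 ?b)"
    by (auto simp: path_image_rectpath_segments closed_segment_commute Complex_eq)
  have lines: "F \<circ> linepath 0 1 = (\<lambda>s. A s - B 0)" "F \<circ> linepath 1 ?b = (\<lambda>t. A 1 - B t)"
    "F \<circ> linepath \<i> ?b = (\<lambda>s. A s - B 1)" "F \<circ> linepath 0 \<i> = (\<lambda>t. A 0 - B t)"
    by (auto simp: F_def linepath_def fun_eq_iff)
  have "0 \<notin> F ` path_image (rectpath 0 ?b)"
    using side by force
  then have "winding_number (F \<circ> rectpath 0 ?b) 0 =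
     winding_number (F \<circ> linepath 0 1) 0 + winding_number (F \<circ> linepath 1 ?b) 0 +
     winding_number (F \<circ> linepath ?b \<i>) 0 + winding_number (F \<circ> linepath \<i> 0) 0"
    using winding_number_image_rectpath[of 0 ?b F 0] continuous_on_subset[OF cont_F sub]
    by (auto simp: Complex_eq)
  also have "winding_number (F \<circ> linepath ?b \<i>) 0 = - winding_number (F \<circ> linepath \<i> ?b) 0"
    using segs(1) side sub by (intro winding_number_image_linepath_reverse continuous_on_subset[OF cont_F]) auto
  also have "winding_number (F \<circ> linepath \<i> 0) 0 = - winding_number (F \<circ> linepath 0 \<i>) 0"
    using segs(2) side sub by (intro winding_number_image_linepath_reverse continuous_on_subset[OF cont_F]) auto
  finally have "winding_number (F \<circ> rectpath 0 ?b) 0 =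
    winding_number A (B 0) + winding_number B (A 1) - winding_number A (B 1) - winding_number B (A 0)"
    unfolding lines winding_number_offset[of A, symmetric]
    by (simp only: neg insert_iff simp_thms diff_conv_add_uminus[symmetric])
  then show ?thesis using par unfolding card by simp
qed

section \<open>Graphs realized as circles\<close>

lemma vertex_point_nth: "vertex_point x $ z = (if z = x then 1 else 0)"
  by (simp add: axis_def)

lemma edge_path_nth:
  "edge_path x y t $ z = (if z = x then 1 - t else 0) + (if z = y then t else 0)"
  by (simp add: linepath_def axis_def)

lemma convex_hull_edge: "convex hull (vertex_point ` {x, y}) = edge_path x y ` {0..1}"
  by (simp add: linepath_image_01 segment_convex_hull)

lemma edge_path_reverse: "edge_path y x t = edge_path x y (1 - t)"
  by (simp add: linepath_def algebra_simps)

text \<open>An interior point of an edge has exactly two nonzero coordinates. Their positions give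
  the edge and their values the parameter, up to reversal.\<close>

lemma edge_path_eq_cases:
  assumes eq: "edge_path x y s = edge_path x' y' t" and neq: "x \<noteq> y" "x' \<noteq> y'"
    and s: "0 < s" "s < 1"
  shows "x' = x \<and> y' = y \<and> t = s \<or> x' = y \<and> y' = x \<and> t = 1 - s"
proof -
  have *: "(if z = x then 1 - s else 0) + (if z = y then s else 0) =
        (if z = x' then 1 - t else 0) + (if z = y' then t else 0)" for z
    using arg_cong[OF eq, of "\<lambda>v :: real ^ _. v $ z"] by (simp add: edge_path_nth)
  have "x \<in> {x', y'}" "y \<in> {x', y'}"
    using *[of x] *[of y] neq s by (auto split: if_splits)
  then show ?thesis
    using *[of x] *[of y] neq by auto
qed

lemma simple_graph_edge:
  assumes "simple_graph H" "e \<in> edges H" "v \<in> e"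
  obtains y where "y \<noteq> v" "e = {v, y}" "v \<in> verts H" "y \<in> verts H"
proof -
  have "card e = 2" "e \<subseteq> verts H" using assms by (auto simp: simple_graph_def)
  then obtain x y where "e = {x, y}" "x \<noteq> y" by (meson card_2_iff)
  then show ?thesis
    using that[of x] that[of y] assms(3) \<open>e \<subseteq> verts H\<close> by (auto simp: insert_commute)
qed

lemma realization_edge_pathI:
  "{x, y} \<in> edges H \<Longrightarrow> t \<in> {0..1} \<Longrightarrow> edge_path x y t \<in> realization H"
  unfolding realization_def using convex_hull_edge[of x y] by blast

lemma realization_cases:
  assumes "simple_graph H" "q \<in> realization H"
  obtains v where "v \<in> verts H" "q = vertex_point v"
  | x y t where "{x, y} \<in> edges H" "x \<noteq> y" "0 < t" "t < 1" "q = edge_path x y t"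
proof -
  consider v where "v \<in> verts H" "q = vertex_point v"
    | e where "e \<in> edges H" "q \<in> convex hull (vertex_point ` e)"
    using assms(2) by (auto simp: realization_def)
  then show ?thesis
  proof cases
    case 2
    from assms(1) 2(1) have "card e = 2" by (simp add: simple_graph_def)
    then obtain x y where xy: "e = {x, y}" "x \<noteq> y" by (meson card_2_iff)
    then obtain t where t: "t \<in> {0..1}" "q = edge_path x y t"
      using 2(2) convex_hull_edge[of x y] by auto
    have vs: "x \<in> verts H" "y \<in> verts H"
      using assms(1) 2(1) xy(1) by (auto simp: simple_graph_def)
    show ?thesis
    proof (cases "t = 0 \<or> t = 1")
      case True
      then show ?thesis using that(1) vs t(2) by (auto simp: linepath_0' linepath_1')
    next
      case False
      then show ?thesis using that(2)[of x y t] 2(1) xy t by auto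
    qed
  qed (use that in blast)
qed

lemma vertex_point_neq_edge_path:
  assumes "x \<noteq> y" "0 < t" "t < 1"
  shows "vertex_point v \<noteq> edge_path x y t"
proof
  assume "vertex_point v = edge_path x y t"
  from arg_cong[OF this, of "\<lambda>q :: real ^ _. q $ v"] show False
    using assms by (auto simp: edge_path_nth vertex_point_nth split: if_splits)
qed

text \<open>The points with nonzero coordinate \<open>v\<close> form the open star of
  \<open>v\<close>.\<close>

lemma realization_star_cases:
  fixes q :: "real ^ 'v::finite"
  assumes "simple_graph H" "q \<in> realization H" "q $ v \<noteq> 0" "q \<noteq> vertex_point v"
  obtains y t where "{v, y} \<in> edges H" "y \<noteq> v" "0 < t" "t < 1" "q = edge_path v y t"
  using assms(1,2)
proof (cases rule: realization_cases)
  case (1 w)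
  then show ?thesis using assms(3,4) by (auto simp: vertex_point_nth split: if_splits)
next
  case (2 x y t)
  then consider "x = v" | "y = v"
    using assms(3) by (auto simp: edge_path_nth split: if_splits)
  then show ?thesis
  proof cases
    case 1 then show ?thesis using that 2 by blast
  next
    case b: 2
    have "q = edge_path v x (1 - t)" using 2(5) b edge_path_reverse[of x v t] by (metis edge_path_reverse)
    then show ?thesis using that[of x "1 - t"] 2 b by (simp add: insert_commute)
  qed
qed

section \<open>Vertex degrees in a subgraph that is a circle\<close>

lemma punctured_circle_homeomorphic_real:
  assumes "S homeomorphic sphere (0 :: real ^ 2) 1" "p \<in> S"
  shows "(S - {p}) homeomorphic (UNIV :: real set)"
proof -
  obtain h k where hk: "homeomorphism S (sphere (0 :: real ^ 2) 1) h k"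
    using assms(1) by (auto simp: homeomorphic_def)
  then have "inj_on h S" "h ` S = sphere 0 1"
    by (auto simp: homeomorphism_def intro: inj_on_inverseI)
  then have "h ` (S - {p}) = sphere 0 1 - {h p}"
    using assms(2) by (auto simp: inj_on_def)
  then have "(S - {p}) homeomorphic (sphere (0 :: real ^ 2) 1 - {h p})"
    using homeomorphism_of_subsets[OF hk, of "S - {p}" "sphere 0 1 - {h p}"]
    by (auto simp: homeomorphic_def)
  also have "(sphere (0 :: real ^ 2) 1 - {h p}) homeomorphic (UNIV :: real set)"
    using \<open>h ` S = sphere 0 1\<close> assms(2)
    by (intro homeomorphic_punctured_sphere_affine) auto
  finally show ?thesis .
qed

text \<open>A tripod does not embed in the line: two of its legs would leave the branch point in the
  same direction and meet again.\<close>

lemma no_tripod_in_line: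
  fixes \<gamma> :: "nat \<Rightarrow> real \<Rightarrow> real"
  assumes cont: "\<And>i. i < 3 \<Longrightarrow> continuous_on {0..1} (\<gamma> i)"
    and start: "\<And>i. i < 3 \<Longrightarrow> \<gamma> i 0 = c"
    and inj: "\<And>i j s t. i < 3 \<Longrightarrow> j < 3 \<Longrightarrow> s \<in> {0<..1} \<Longrightarrow> t \<in> {0..1} \<Longrightarrow>
      \<gamma> i s = \<gamma> j t \<Longrightarrow> i = j"
    and leave: "\<And>i. i < 3 \<Longrightarrow> \<gamma> i 1 \<noteq> c"
  shows False
proof -
  have same: False if ij: "i < 3" "j < 3" "i \<noteq> j" and le: "\<bar>\<gamma> i 1 - c\<bar> \<le> \<bar>\<gamma> j 1 - c\<bar>"
    and sgn: "(\<gamma> i 1 - c) * (\<gamma> j 1 - c) > 0" for i j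
  proof -
    have "\<exists>t. 0 \<le> t \<and> t \<le> 1 \<and> \<gamma> j t = \<gamma> i 1"
    proof (cases "\<gamma> i 1 > c")
      case True
      then have "\<gamma> j 1 > c" using sgn by (simp add: zero_less_mult_iff)
      then show ?thesis
        using True le start ij cont by (intro IVT') auto
    next
      case False
      then have "\<gamma> i 1 < c" "\<gamma> j 1 < c" using sgn by (auto simp: zero_less_mult_iff)
      then show ?thesis
        using le start ij cont by (intro IVT2') auto
    qed
    then obtain t where "t \<in> {0..1}" "\<gamma> i 1 = \<gamma> j t" by force
    then show False using inj[of i j 1 t] ij by simp
  qed
  have opp: "(\<gamma> i 1 - c) * (\<gamma> j 1 - c) < 0" if "i < 3" "j < 3" "i \<noteq> j" for i j
    using same[of i j] same[of j i] that leave[of i] leave[of j]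
    by (metis linorder_linear linorder_neqE_linordered_idom mult.commute mult_eq_0_iff right_minus_eq)
  show False
    using opp[of 0 1] opp[of 1 2] opp[of 0 2] by (auto simp: mult_less_0_iff)
qed

text \<open>Three edges at \<open>v\<close> contain a tripod. Removing the far end of one of them
  turns the circle into a line, in which the tripod would still be embedded.\<close>

lemma circle_realization_degree_le:
  fixes H :: "'v::finite ugraph"
  assumes H: "simple_graph H" and circle: "realization H homeomorphic sphere (0 :: real ^ 2) 1"
  shows "card {e \<in> edges H. v \<in> e} \<le> 2"
proof (rule ccontr)
  let ?E = "{e \<in> edges H. v \<in> e}"
  assume "\<not> card ?E \<le> 2"
  then obtain T where T: "T \<subseteq> ?E" "card T = 3"
    using obtain_subset_with_card_n[of 3 ?E] by auto
  then obtain e where "bij_betw e {..<3::nat} T"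
    by (metis card.infinite ex_bij_betw_nat_finite lessThan_atLeast0 zero_neq_numeral)
  then have e: "inj_on e {..<3}" "\<And>i. i < 3 \<Longrightarrow> e i \<in> edges H \<and> v \<in> e i"
    using T(1) by (auto simp: bij_betw_def)
  have "\<exists>y. y \<noteq> v \<and> e i = {v, y}" if "i < 3" for i
    using simple_graph_edge[OF H, of "e i" v] e(2)[OF that] by blast
  then obtain y where y: "\<And>i. i < 3 \<Longrightarrow> y i \<noteq> v \<and> e i = {v, y i}" by metis
  let ?R = "realization H"
  have "e 0 \<subseteq> verts H"
    using e(2)[of 0] H by (simp add: simple_graph_def)
  moreover have "y 0 \<in> e 0"
    using y[of 0] by auto
  ultimately have y0: "vertex_point (y 0) \<in> ?R"
    unfolding realization_def by blast
  obtain g k where "homeomorphism (?R - {vertex_point (y 0)}) (UNIV :: real set) g k"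
    using punctured_circle_homeomorphic_real[OF circle y0] unfolding homeomorphic_def by blast
  then have g: "continuous_on (?R - {vertex_point (y 0)}) g" "inj_on g (?R - {vertex_point (y 0)})"
    unfolding homeomorphism_def by (simp, metis inj_on_inverseI)
  \<comment> \<open>Only the halves of the edges next to \<open>v\<close> are used: there the
    coordinate \<open>v\<close> is positive, so the removed vertex is avoided.\<close>
  let ?leg = "\<lambda>i t. edge_path v (y i) (t / 2)"
  have leg_in: "?leg i t \<in> ?R - {vertex_point (y 0)}" if "i < 3" "t \<in> {0..1}" for i t
  proof -
    have "?leg i t \<in> ?R"
      using that e(2)[of i] y[of i] by (intro realization_edge_pathI) auto
    moreover have "?leg i t $ v > 0"
      using that y[of i] by (auto simp: edge_path_nth)
    then have "?leg i t \<noteq> vertex_point (y 0)"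
      using y[of 0] by (auto simp: vertex_point_nth)
    ultimately show ?thesis by simp
  qed
  show False
  proof (rule no_tripod_in_line[of "\<lambda>i t. g (?leg i t)" "g (vertex_point v)"])
    fix i :: nat assume i: "i < 3"
    show "continuous_on {0..1} (\<lambda>t. g (?leg i t))"
      by (rule continuous_on_compose2[OF g(1)])
         (use leg_in[OF i] in \<open>auto simp: linepath_def intro!: continuous_intros\<close>)
    show "g (?leg i 0) = g (vertex_point v)" by (simp add: linepath_0')
    show "g (?leg i 1) \<noteq> g (vertex_point v)"
    proof
      assume "g (?leg i 1) = g (vertex_point v)"
      then have "?leg i 1 = vertex_point v"
        using inj_onD[OF g(2)] leg_in[OF i, of 1] leg_in[OF i, of 0] by (auto simp: linepath_0')
      then show False using vertex_point_neq_edge_path[of v "y i" "1/2" v] y[OF i] by auto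
    qed
  next
    fix i j :: nat and s t :: real
    assume ij: "i < 3" "j < 3" and st: "s \<in> {0<..1}" "t \<in> {0..1}"
      and eq: "g (?leg i s) = g (?leg j t)"
    have "?leg i s = ?leg j t"
      using inj_onD[OF g(2) eq] leg_in ij st by auto
    then have "y j = y i"
      using edge_path_eq_cases[of v "y i" "s/2" v "y j" "t/2"] y[OF ij(1)] y[OF ij(2)] st by auto
    then show "i = j" using y ij e(1) by (metis inj_onD lessThan_iff)
  qed
qed

text \<open>A circle stays connected when one point is removed. If at most one edge ends at
  \<open>v\<close>, removing its midpoint (or, for isolated \<open>v\<close>, any other point) cuts
  \<open>v\<close> off from the rest.\<close>

lemma circle_realization_degree_ge:
  fixes H :: "'v::finite ugraph"
  assumes H: "simple_graph H" and circle: "realization H homeomorphic sphere (0 :: real ^ 2) 1"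
    and v: "v \<in> verts H"
  shows "card {e \<in> edges H. v \<in> e} \<ge> 2"
proof (rule ccontr)
  let ?E = "{e \<in> edges H. v \<in> e}" and ?R = "realization H"
  assume "\<not> card ?E \<ge> 2"
  then have card: "card ?E = 0 \<or> card ?E = 1" by linarith
  have vR: "vertex_point v \<in> ?R" using v by (simp add: realization_def)
  have "infinite (?R - {p})" if "p \<in> ?R" for p
  proof
    assume "finite (?R - {p})"
    from homeomorphic_finite[OF this, of "UNIV :: real set"] show False
      using punctured_circle_homeomorphic_real[OF circle that] homeomorphic_sym[of "?R - {p}"]
        infinite_UNIV_char_0[where 'a = real] by blast
  qed
  then have inf: "infinite ?R" using vR by (metis finite_Diff)
  have conn: "connected (?R - {p})" if "p \<in> ?R" for p
    using homeomorphic_connectedness[OF punctured_circle_homeomorphic_real[OF circle that]] by simp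
  have fin: "finite ?E" using finite_subset[of ?E "Pow UNIV"] by auto
  \<comment> \<open>A form common to both degrees: without \<open>m\<close> the value 1/2 of
    coordinate \<open>v\<close> is not attained, while values occur on both sides of it, at
    \<open>q\<close> and at \<open>v\<close> itself.\<close>
  have "\<exists>m q. m \<in> ?R \<and> q \<in> ?R \<and> q \<noteq> m \<and> m \<noteq> vertex_point v \<and> q $ v < 1/2 \<and>
      (\<forall>w\<in>?R. w $ v = 1/2 \<longrightarrow> w = m)"
    using card
  proof
    assume "card ?E = 0"
    then have "?E = {}" using fin by simp
    then have 0: "w $ v = 0" if "w \<in> ?R" "w \<noteq> vertex_point v" for w
      using realization_star_cases[OF H that(1) _ that(2)] by blast
    obtain m where m: "m \<in> ?R" "m \<noteq> vertex_point v"
      using infinite_imp_nonempty[OF Diff_infinite_finite[OF _ inf, of "{vertex_point v}"]] by auto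
    obtain q where q: "q \<in> ?R" "q \<notin> {m, vertex_point v}"
      using infinite_imp_nonempty[OF Diff_infinite_finite[OF _ inf, of "{m, vertex_point v}"]] by auto
    have "w $ v \<noteq> 1/2" if "w \<in> ?R" for w
      using 0[OF that] by (cases "w = vertex_point v") (auto simp: vertex_point_nth)
    moreover have "q $ v < 1/2"
      using 0[OF q(1)] q(2) by simp
    ultimately show ?thesis
      using m q by blast
  next
    assume "card ?E = 1"
    then obtain e where e: "?E = {e}" by (meson card_1_singletonE)
    then have "e \<in> edges H" "v \<in> e"
      by blast+
    then obtain y where y: "y \<noteq> v" "e = {v, y}" "y \<in> verts H"
      using simple_graph_edge[OF H] by metis
    have "{v, y} \<in> edges H" using \<open>e \<in> edges H\<close> y(2) by simp
    then have mR: "edge_path v y (1/2) \<in> ?R" by (intro realization_edge_pathI) auto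
    have yR: "vertex_point y \<in> ?R" using y(3) by (auto simp: realization_def)
    have ne: "edge_path v y (1/2) \<noteq> vertex_point v" "vertex_point y \<noteq> edge_path v y (1/2)" 
      using vertex_point_neq_edge_path[of v y "1/2", symmetric] vertex_point_neq_edge_path[of v y "1/2"] y(1) by simp_all
    have uniq: "w = edge_path v y (1/2)" if w: "w \<in> ?R" "w $ v = 1/2" for w
    proof -
      have "w \<noteq> vertex_point v" "w $ v \<noteq> 0"
        using w(2) by (auto simp: vertex_point_nth)
      then obtain y' t where w': "{v, y'} \<in> edges H" "y' \<noteq> v" "w = edge_path v y' t"
        using realization_star_cases[OF H w(1)] by metis
      have "{v, y'} \<in> ?E" using w'(1) by simp
      then have "{v, y'} = {v, y}" unfolding e y(2) by simp
      then have "y' = y" using w'(2) by (auto simp: doubleton_eq_iff)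
      moreover have "t = 1/2"
        using w(2) w'(2) by (simp add: w'(3) edge_path_nth)
      ultimately show ?thesis by (simp only: w'(3))
    qed
    have "vertex_point y $ v < (1/2 :: real)"
      using y(1) by (simp add: vertex_point_nth)
    then show ?thesis
      by (intro exI[of _ "edge_path v y (1/2)"] exI[of _ "vertex_point y"] conjI ballI impI
          mR yR ne uniq)
  qed
  then obtain m q where m: "m \<in> ?R" "m \<noteq> vertex_point v" and q: "q \<in> ?R" "q \<noteq> m" "q $ v < 1/2"
    and uniq: "\<And>w. w \<in> ?R \<Longrightarrow> w $ v = 1/2 \<Longrightarrow> w = m" by blast
  let ?U = "{w :: real ^ 'v. w $ v > 1/2}" and ?V = "{w :: real ^ 'v. w $ v < 1/2}"
  have "open ?U" "open ?V"
    by (auto intro!: open_Collect_less continuous_intros)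
  moreover have "?R - {m} \<subseteq> ?U \<union> ?V"
  proof
    fix w assume "w \<in> ?R - {m}"
    then have "w $ v \<noteq> 1/2" using uniq[of w] by blast
    then have "w $ v < 1/2 \<or> w $ v > 1/2" by linarith
    then show "w \<in> ?U \<union> ?V" by blast
  qed
  moreover have "vertex_point v \<in> ?U \<inter> (?R - {m})" "q \<in> ?V \<inter> (?R - {m})"
    using m q vR by (auto simp: vertex_point_nth)
  moreover have "?U \<inter> ?V = {}" by auto
  ultimately show False
    using connectedD[OF conn[OF m(1)], of ?U ?V] by blast
qed

theorem circle_realization_degree:
  fixes H :: "'v::finite ugraph"
  assumes "simple_graph H" "realization H homeomorphic sphere (0 :: real ^ 2) 1" "v \<in> verts H"
  shows "card {e \<in> edges H. v \<in> e} = 2"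
  using circle_realization_degree_le[OF assms(1,2)] circle_realization_degree_ge[OF assms]
  by (simp add: le_antisym)

section \<open>Closed walks without repeated vertices as circles\<close>

fun walk_edges :: "'v list \<Rightarrow> 'v set list" where
  "walk_edges (x # y # xs) = {x, y} # walk_edges (y # xs)"
| "walk_edges _ = []"

fun walk_path :: "'v::finite list \<Rightarrow> real \<Rightarrow> real ^ 'v" where
  "walk_path [x, y] = edge_path x y"
| "walk_path (x # y # xs) = edge_path x y +++ walk_path (y # xs)"
| "walk_path _ = undefined"

lemma Union_walk_edges: "length xs \<ge> 2 \<Longrightarrow> \<Union> (set (walk_edges xs)) = set xs"
proof (induction xs rule: walk_edges.induct)
  case (1 x y xs)
  then show ?case by (cases xs) auto
qed auto

lemma pathstart_walk_path: "length xs \<ge> 2 \<Longrightarrow> pathstart (walk_path xs) = vertex_point (hd xs)"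
  by (induction xs rule: walk_path.induct) auto

lemma pathfinish_walk_path: "length xs \<ge> 2 \<Longrightarrow> pathfinish (walk_path xs) = vertex_point (last xs)"
  by (induction xs rule: walk_path.induct) auto

lemma path_image_walk_path:
  "length xs \<ge> 2 \<Longrightarrow> path_image (walk_path xs) = (\<Union>e\<in>set (walk_edges xs). convex hull (vertex_point ` e))"
  by (induction xs rule: walk_path.induct)
     (auto simp: path_image_join pathstart_walk_path segment_convex_hull)

lemma edge_point_coords:
  fixes q :: "real ^ 'v::finite"
  assumes "q \<in> convex hull (vertex_point ` {x, y})"
  shows "q $ z \<noteq> 0 \<Longrightarrow> z \<in> {x, y}"
  using assms unfolding convex_hull_edge by (auto simp: edge_path_nth split: if_splits)

lemma edge_point_vertex:
  fixes q :: "real ^ 'v::finite"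
  assumes "q \<in> convex hull (vertex_point ` {x, y})" "q $ y = 0"
  shows "q = vertex_point x"
  using assms unfolding convex_hull_edge
  by (auto simp: edge_path_nth vec_eq_iff vertex_point_nth split: if_splits)

lemma walk_path_coords:
  fixes q :: "real ^ 'v::finite"
  assumes "q \<in> (\<Union>e\<in>set (walk_edges xs). convex hull (vertex_point ` e))" "q $ z \<noteq> 0"
  shows "z \<in> set xs"
  using assms
proof (induction xs rule: walk_edges.induct)
  case (1 x y xs)
  then show ?case using edge_point_coords[of q x y z] by auto
qed auto

text \<open>The rest of the walk avoids the first vertex \<open>x\<close>, so its points have
  coordinate 0 at \<open>x\<close>; on the first edge this leaves only the end
  \<open>y\<close>.\<close>

lemma arc_walk_path: "length xs \<ge> 2 \<Longrightarrow> distinct xs \<Longrightarrow> arc (walk_path xs)"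
proof (induction xs rule: walk_path.induct)
  case (1 x y)
  then show ?case by (simp add: arc_linepath axis_eq_axis)
next
  case (2 x y z zs)
  have "arc (edge_path x y +++ walk_path (y # z # zs))"
  proof (rule arc_join)
    show "path_image (edge_path x y) \<inter> path_image (walk_path (y # z # zs)) \<subseteq>
        {pathstart (walk_path (y # z # zs))}"
    proof
      fix q assume q: "q \<in> path_image (edge_path x y) \<inter> path_image (walk_path (y # z # zs))"
      then have "q \<in> (\<Union>e\<in>set (walk_edges (y # z # zs)). convex hull (vertex_point ` e))"
        using path_image_walk_path[of "y # z # zs"] by (simp del: walk_edges.simps)
      moreover have "x \<notin> set (y # z # zs)"
        using "2.prems" by simp
      ultimately have qx: "q $ x = 0"
        using walk_path_coords by blast
      have "q \<in> convex hull (vertex_point ` {y, x})"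
        using q by (simp only: Int_iff path_image_linepath segment_convex_hull image_insert image_empty insert_commute)
      then have "q = vertex_point y"
        using qx by (rule edge_point_vertex)
      then show "q \<in> {pathstart (walk_path (y # z # zs))}"
        by (simp add: pathstart_walk_path)
    qed
  qed (use 2 in \<open>auto simp: pathstart_walk_path arc_linepath axis_eq_axis\<close>)
  then show ?case by simp
qed auto

text \<open>The walk is an arc, and the closing edge meets it only in its two ends, so both together
  form a simple closed path. With three or more vertices the closing edge differs from all edges of
  the walk.\<close>

theorem closed_walk_homeomorphic_circle:
  fixes xs :: "'v::finite list"
  assumes xs: "distinct xs" "length xs \<ge> 3"
    and H: "edges H = insert {last xs, hd xs} (set (walk_edges xs))" "verts H = set xs"
  shows "realization H homeomorphic sphere (0 :: real ^ 2) 1"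
proof -
  let ?p = "walk_path xs" and ?e = "edge_path (last xs) (hd xs)"
  have ne: "last xs \<noteq> hd xs"
    using xs by (cases xs; cases "tl xs") auto
  have len: "length xs \<ge> 2" using xs(2) by simp
  have "simple_path (?p +++ ?e)"
  proof (rule simple_path_join_loop)
    show "arc ?p" using arc_walk_path xs len by blast
    show "arc ?e" using ne by (simp add: arc_linepath axis_eq_axis)
    show "path_image ?p \<inter> path_image ?e \<subseteq> {pathstart ?p, pathstart ?e}"
    proof
      fix q assume q: "q \<in> path_image ?p \<inter> path_image ?e"
      obtain x y z zs where xs': "xs = x # y # z # zs"
        using xs(2) by (auto simp: numeral_3_eq_3 Suc_le_length_iff)
      have last: "last xs \<noteq> x" "last xs \<noteq> y"
        using xs(1) unfolding xs' by auto
      have qe: "q \<in> convex hull (vertex_point ` {last xs, x})"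
        using q by (simp only: Int_iff path_image_linepath segment_convex_hull image_insert image_empty xs' list.sel)
      have "q \<in> convex hull (vertex_point ` {x, y}) \<or>
          q \<in> (\<Union>e\<in>set (walk_edges (y # z # zs)). convex hull (vertex_point ` e))"
        using q path_image_walk_path[OF len] by (auto simp: xs')
      moreover have "x \<notin> set (y # z # zs)"
        using xs(1) unfolding xs' by simp
      \<comment> \<open>The first edge of the walk has no coordinate at \<open>last xs\<close>, the
        later ones none at \<open>x\<close>. A point of the closing edge that lacks either
        coordinate is an end of it.\<close>
      ultimately have "q $ last xs = 0 \<or> q $ x = 0"
        using edge_point_coords[of q x y "last xs"] walk_path_coords[of q "y # z # zs" x] last
        by blast
      then have "q = vertex_point x \<or> q = vertex_point (last xs)"
        using edge_point_vertex[OF qe] edge_point_vertex[OF qe[unfolded insert_commute[of "last xs"]]]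
        by blast
      then show "q \<in> {pathstart ?p, pathstart ?e}"
        using len by (auto simp: pathstart_walk_path xs')
    qed
  qed (use len in \<open>auto simp: pathstart_walk_path pathfinish_walk_path\<close>)
  then have "path_image (?p +++ ?e) homeomorphic sphere (0 :: complex) 1"
    using len by (intro homeomorphic_simple_path_image_circle) (auto simp: pathstart_walk_path)
  also have "sphere (0 :: complex) 1 homeomorphic sphere (0 :: real ^ 2) 1"
    by (intro homeomorphic_spheres_gen) auto
  also have "path_image (?p +++ ?e) = realization H"
  proof -
    have "vertex_point v \<in> (\<Union>e\<in>set (walk_edges xs). convex hull (vertex_point ` e))"
      if v: "v \<in> set xs" for v
    proof -
      obtain e where "e \<in> set (walk_edges xs)" "v \<in> e"
        using v Union_walk_edges[OF len] by blast
      then show ?thesis using hull_inc[of "vertex_point v" "vertex_point ` e"] by blast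
    qed
    moreover have "path_image ?e = convex hull (vertex_point ` {last xs, hd xs})"
      by (simp add: segment_convex_hull)
    ultimately show ?thesis
      unfolding realization_def H
      using len by (auto simp: path_image_join path_image_walk_path pathfinish_walk_path)
  qed
  finally show ?thesis .
qed

section \<open>Cycles of the Petersen graph\<close>

text \<open>Vertex \<open>i < 5\<close> stands for \<open>u(i)\<close> and vertex \<open>5 + i\<close> for \<open>v(i)\<close>. Edges 0 to 4 are the
  \<open>{u(i), u(i+1)}\<close>, edges 5 to 9 the \<open>{u(i), v(i)}\<close>, edges 10 to 14 the \<open>{v(i), v(i+2)}\<close>.\<close>

definition petersen_ends :: "(nat \<times> nat) list" where
  "petersen_ends = [(0, 1), (1, 2), (2, 3), (3, 4), (4, 0), (0, 5), (1, 6), (2, 7), (3, 8), (4, 9),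
     (5, 7), (6, 8), (7, 9), (8, 5), (9, 6)]"

definition src :: "nat \<Rightarrow> nat" where "src i = fst (petersen_ends ! i)"

definition tgt :: "nat \<Rightarrow> nat" where "tgt i = snd (petersen_ends ! i)"

definition inc :: "nat \<Rightarrow> nat \<Rightarrow> bool" where
  "inc v i \<longleftrightarrow> v = src i \<or> v = tgt i"

text \<open>In type \<open>5\<close> the number \<open>of_nat (5 + i)\<close> equals
  \<open>of_nat i\<close>, so the index of an inner vertex needs no subtraction.\<close>

definition petersen_vertex_of :: "nat \<Rightarrow> petersen_vertex" where
  "petersen_vertex_of n = (if n < 5 then Inl (of_nat n) else Inr (of_nat n))"

definition petersen_edge :: "nat \<Rightarrow> petersen_vertex set" where
  "petersen_edge i = {petersen_vertex_of (src i), petersen_vertex_of (tgt i)}"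

lemma list_all_upt: "list_all P [0..<n] \<longleftrightarrow> (\<forall>i<n. P i)"
  by (auto simp: list_all_iff)

lemma upt_15: "[0..<15] = [0, 1, 2, 3, 4, 5, 6, 7, 8, 9, 10, 11, 12, 13, 14]"
  by code_simp

lemma of_nat_5_eq_iff: "(of_nat x :: 5) = of_nat y \<longleftrightarrow> x mod 5 = y mod 5"
  by (simp add: of_nat_eq_iff_cong_CHAR cong_def)

lemma bij_petersen_vertex_of: "bij_betw petersen_vertex_of {..<10} UNIV"
proof -
  have "x = y" if "x < 10" "y < 10" "petersen_vertex_of x = petersen_vertex_of y" for x y
    using that by (cases "x < 5"; cases "y < 5") (auto simp: petersen_vertex_of_def of_nat_5_eq_iff le_mod_geq)
  then have inj: "inj_on petersen_vertex_of {..<10}"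
    by (simp add: inj_on_def)
  moreover have "petersen_vertex_of ` {..<10} = UNIV"
    by (rule card_subset_eq) (simp_all add: card_image[OF inj])
  ultimately show ?thesis by (simp add: bij_betw_def)
qed

lemma petersen_vertex_of_eq_iff: "v < 10 \<Longrightarrow> w < 10 \<Longrightarrow> petersen_vertex_of v = petersen_vertex_of w \<longleftrightarrow> v = w"
  using bij_petersen_vertex_of by (auto simp: bij_betw_def inj_on_def)

lemma verts_petersen: "verts petersen = UNIV"
  by (simp add: petersen_def)

lemma edges_petersen: "edges petersen = petersen_edge ` {..<15}"
proof -
  have "inj_on (of_nat :: nat \<Rightarrow> 5) {..<5}"
    by (simp add: inj_on_def of_nat_5_eq_iff)
  then have "(UNIV :: 5 set) = of_nat ` {..<5}"
    by (intro card_subset_eq[symmetric]) (simp_all add: card_image)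
  also have "\<dots> = {0, 1, 2, 3, 4}"
    by (simp add: lessThan_Suc numeral_eq_Suc insert_commute)
  finally have UNIV_5: "(UNIV :: 5 set) = {0, 1, 2, 3, 4}" .
  have five: "(5 :: 5) = 0" "(6 :: 5) = 1" "(7 :: 5) = 2" "(8 :: 5) = 3" "(9 :: 5) = 4"
    by simp_all
  have "{..<15::nat} = {0, 1, 2, 3, 4, 5, 6, 7, 8, 9, 10, 11, 12, 13, 14}"
    unfolding atLeast_upt upt_15 by (simp only: list.set)
  then have "petersen_edge ` {..<15} = {petersen_edge 0, petersen_edge 1, petersen_edge 2, petersen_edge 3, petersen_edge 4,
      petersen_edge 5, petersen_edge 6, petersen_edge 7, petersen_edge 8, petersen_edge 9, petersen_edge 10, petersen_edge 11, petersen_edge 12,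
      petersen_edge 13, petersen_edge 14}"
    by (simp only: image_insert image_empty)
  also have "\<dots> = edges petersen"
    unfolding petersen_def UNIV_5
    by (simp add: petersen_edge_def petersen_vertex_of_def src_def tgt_def petersen_ends_def five insert_commute Un_insert_left)
  finally show ?thesis by simp
qed

lemma ends_less: "i < 15 \<Longrightarrow> src i < 10" "i < 15 \<Longrightarrow> tgt i < 10"
  and src_neq_tgt: "i < 15 \<Longrightarrow> src i \<noteq> tgt i"
proof -
  have "list_all (\<lambda>i. src i < 10 \<and> tgt i < 10 \<and> src i \<noteq> tgt i) [0..<15]"
    by code_simp
  then show "i < 15 \<Longrightarrow> src i < 10" "i < 15 \<Longrightarrow> tgt i < 10" "i < 15 \<Longrightarrow> src i \<noteq> tgt i"
    by (simp_all add: list_all_upt)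
qed

lemma petersen_vertex_of_ends_neq: "i < 15 \<Longrightarrow> petersen_vertex_of (src i) \<noteq> petersen_vertex_of (tgt i)"
  by (simp add: petersen_vertex_of_eq_iff ends_less src_neq_tgt)

lemma petersen_vertex_of_in_petersen_edge: "v < 10 \<Longrightarrow> i < 15 \<Longrightarrow> petersen_vertex_of v \<in> petersen_edge i \<longleftrightarrow> inc v i"
  by (simp add: petersen_edge_def inc_def petersen_vertex_of_eq_iff ends_less)

lemma inj_petersen_edge: "inj_on petersen_edge {..<15}"
proof (rule inj_onI)
  fix i j assume ij: "i \<in> {..<15::nat}" "j \<in> {..<15}" "petersen_edge i = petersen_edge j"
  then have "inc (src i) j" "inc (tgt i) j"
    using petersen_vertex_of_in_petersen_edge[of _ i] petersen_vertex_of_in_petersen_edge[of _ j] ends_less[of i]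
    by (auto simp: inc_def)
  moreover have "list_all (\<lambda>i. list_all (\<lambda>j. inc (src i) j \<and> inc (tgt i) j \<longrightarrow> i = j) [0..<15]) [0..<15]"
    by code_simp
  ultimately show "i = j" using ij by (simp add: list_all_upt)
qed

text \<open>An edge set of even degree everywhere is determined by its six edges 0 to 4 and 10. As the
  girth is 5, one with fewer than ten edges is a cycle or empty.\<close>

fun even_row :: "bool list \<Rightarrow> bool list" where
  "even_row [a0, a1, a2, a3, a4, c0] =
     (let b0 = a0 \<noteq> a4; b1 = a1 \<noteq> a0; b2 = a2 \<noteq> a1; b3 = a3 \<noteq> a2; b4 = a4 \<noteq> a3;
          c2 = c0 \<noteq> b2; c4 = c2 \<noteq> b4; c1 = c4 \<noteq> b1; c3 = c1 \<noteq> b3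
      in [a0, a1, a2, a3, a4, b0, b1, b2, b3, b4, c0, c1, c2, c3, c4])"
| "even_row _ = []"

text \<open>The cycle space modulo 2 of a connected graph with 10 vertices and 15 edges has
  dimension 15 - 10 + 1 = 6; these are its 64 elements.\<close>

definition even_rows :: "bool list list" where
  "even_rows = map even_row (List.n_lists 6 [False, True])"

definition cycle_rows :: "nat \<Rightarrow> bool list list" where
  "cycle_rows k = filter (\<lambda>l. length (filter id l) = k) even_rows"

definition row_set :: "bool list \<Rightarrow> nat set" where
  "row_set l = {i. i < 15 \<and> l ! i}"

definition row_graph :: "bool list \<Rightarrow> petersen_vertex ugraph" where
  "row_graph l = \<lparr>verts = \<Union> (petersen_edge ` row_set l), edges = petersen_edge ` row_set l\<rparr>"

lemma length_even_rows: "l \<in> set even_rows \<Longrightarrow> length l = 15"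
proof -
  have "list_all (\<lambda>l. length l = 15) even_rows" by code_simp
  then show "l \<in> set even_rows \<Longrightarrow> length l = 15" by (simp add: list_all_iff)
qed

lemma distinct_even_rows: "distinct even_rows"
  by code_simp

lemma row_set_eqI:
  assumes "length l = 15" "length l' = 15" "row_set l = row_set l'"
  shows "l = l'"
proof (rule nth_equalityI)
  fix i assume "i < length l"
  moreover have "i \<in> row_set l \<longleftrightarrow> i \<in> row_set l'" by (simp only: assms(3))
  ultimately show "l ! i = l' ! i" using assms(1) by (simp add: row_set_def)
qed (use assms in simp)

lemma inj_row_graph: "inj_on row_graph (set even_rows)"
proof (rule inj_onI)
  fix l l' assume l: "l \<in> set even_rows" "l' \<in> set even_rows" "row_graph l = row_graph l'"
  then have "petersen_edge ` row_set l = petersen_edge ` row_set l'" by (simp add: row_graph_def)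
  then have "row_set l = row_set l'"
    by (subst (asm) inj_on_image_eq_iff[OF inj_petersen_edge]) (auto simp: row_set_def)
  then show "l = l'" using l length_even_rows row_set_eqI by blast
qed

lemma card_row_set:
  assumes "length l = 15"
  shows "card (row_set l) = length (filter id l)"
  using assms by (simp add: row_set_def length_filter_conv_card)

lemma even_card_three:
  assumes "distinct [i, j, k]"
  shows "even (card {x. (x = i \<or> x = j \<or> x = k) \<and> P x}) \<longleftrightarrow> (P i \<longleftrightarrow> (P j \<noteq> P k))"
proof -
  have "{x. (x = i \<or> x = j \<or> x = k) \<and> P x} = set (filter P [i, j, k])" by auto
  then have "card {x. (x = i \<or> x = j \<or> x = k) \<and> P x} = length (filter P [i, j, k])"
    using assms by (metis distinct_card distinct_filter)
  then show ?thesis by auto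
qed

lemma even_subgraph_in_even_rows:
  assumes "\<And>v. v < 10 \<Longrightarrow> even (card {i. i < 15 \<and> inc v i \<and> P i})"
  shows "map P [0..<15] \<in> set even_rows"
proof -
  \<comment> \<open>The equation to be proved supplies \<open>i\<close>, \<open>j\<close>,
    \<open>k\<close>; evaluation then confirms that they are exactly the three edges at
    \<open>v\<close>.\<close>
  have parity: "P i \<longleftrightarrow> (P j \<noteq> P k)"
    if *: "v < 10 \<and> distinct [i, j, k] \<and> i < 15 \<and> j < 15 \<and> k < 15 \<and>
      list_all (\<lambda>x. inc v x \<longleftrightarrow> x = i \<or> x = j \<or> x = k) [0..<15]" for v i j k
  proof -
    have "(x < 15 \<and> inc v x) \<and> P x \<longleftrightarrow> (x = i \<or> x = j \<or> x = k) \<and> P x" for x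
      using * by (auto simp: list_all_upt)
    then have "{x. x < 15 \<and> inc v x \<and> P x} = {x. (x = i \<or> x = j \<or> x = k) \<and> P x}"
      by (simp only: conj_assoc)
    then show ?thesis
      using assms[of v] even_card_three[of i j k P] * by metis
  qed
  \<comment> \<open>The outer vertices determine edges 5 to 9; then the inner cycle is followed from
    edge 10 through the vertices 7, 9, 6, 8. Vertex 5 adds no equation, since the sum of all degrees
    is even in any case.\<close>
  have "P 5 = (P 0 \<noteq> P 4)" by (rule parity[where v = 0]) code_simp
  moreover have "P 6 = (P 1 \<noteq> P 0)" by (rule parity[where v = 1]) code_simp
  moreover have "P 7 = (P 2 \<noteq> P 1)" by (rule parity[where v = 2]) code_simp
  moreover have "P 8 = (P 3 \<noteq> P 2)" by (rule parity[where v = 3]) code_simp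
  moreover have "P 9 = (P 4 \<noteq> P 3)" by (rule parity[where v = 4]) code_simp
  moreover have "P 12 = (P 10 \<noteq> P 7)" by (rule parity[where v = 7]) code_simp
  moreover have "P 14 = (P 12 \<noteq> P 9)" by (rule parity[where v = 9]) code_simp
  moreover have "P 11 = (P 14 \<noteq> P 6)" by (rule parity[where v = 6]) code_simp
  moreover have "P 13 = (P 11 \<noteq> P 8)" by (rule parity[where v = 8]) code_simp
  ultimately have "map P [0..<15] = even_row [P 0, P 1, P 2, P 3, P 4, P 10]"
    unfolding even_row.simps Let_def upt_15 by (simp only: list.map)
  moreover have "[P 0, P 1, P 2, P 3, P 4, P 10] \<in> set (List.n_lists 6 [False, True])"
    by (auto simp: set_n_lists)
  ultimately show ?thesis unfolding even_rows_def set_map by (rule image_eqI)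
qed


text \<open>A circle has degree two at its own vertices and zero elsewhere, so its edge set is even.
  It has no isolated vertex, so it is determined by its edges.\<close>

lemma cycle_petersen_row:
  assumes "H \<in> cycles k petersen"
  shows "H \<in> row_graph ` set (cycle_rows k)"
proof -
  have sub: "simple_graph H" "edges H \<subseteq> petersen_edge ` {..<15}"
    and card: "card (edges H) = k"
    and circle: "realization H homeomorphic sphere (0 :: real ^ 2) 1"
    using assms by (auto simp: cycles_def subgraph_def edges_petersen)
  define P where "P i \<longleftrightarrow> petersen_edge i \<in> edges H" for i
  define l where "l = map P [0..<15]"
  have len: "length l = 15" by (simp add: l_def)
  have row_set: "row_set l = {i. i < 15 \<and> P i}"
    by (auto simp: row_set_def l_def)
  have edges: "edges H = petersen_edge ` row_set l"
    using sub(2) by (auto simp: row_set P_def)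
  have "even (card {i. i < 15 \<and> inc v i \<and> P i})" if v: "v < 10" for v
  proof -
    have "{e \<in> edges H. petersen_vertex_of v \<in> e} = petersen_edge ` {i. i < 15 \<and> inc v i \<and> P i}"
      unfolding edges row_set using petersen_vertex_of_in_petersen_edge[OF v] by auto
    moreover have "card (petersen_edge ` {i. i < 15 \<and> inc v i \<and> P i}) = card {i. i < 15 \<and> inc v i \<and> P i}"
      by (rule card_image) (auto intro: inj_on_subset[OF inj_petersen_edge])
    moreover have "even (card {e \<in> edges H. petersen_vertex_of v \<in> e})"
    proof (cases "petersen_vertex_of v \<in> verts H")
      case True
      then show ?thesis using circle_realization_degree[OF sub(1) circle] by simp
    next
      case False
      then have "{e \<in> edges H. petersen_vertex_of v \<in> e} = {}"
        using sub(1) by (auto simp: simple_graph_def)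
      then show ?thesis by (simp only: card.empty even_zero)
    qed
    ultimately show ?thesis by simp
  qed
  then have "l \<in> set even_rows"
    unfolding l_def by (rule even_subgraph_in_even_rows)
  moreover have "length (filter id l) = k"
  proof -
    have "card (petersen_edge ` row_set l) = card (row_set l)"
      by (rule card_image) (auto intro: inj_on_subset[OF inj_petersen_edge] simp: row_set)
    then show ?thesis using card edges card_row_set[OF len] by simp
  qed
  moreover have "H = row_graph l"
  proof -
    have "verts H = \<Union> (edges H)"
    proof
      show "\<Union> (edges H) \<subseteq> verts H" using sub(1) by (auto simp: simple_graph_def)
      show "verts H \<subseteq> \<Union> (edges H)"
      proof
        fix v assume "v \<in> verts H"
        then have "card {e \<in> edges H. v \<in> e} \<noteq> 0"
          using circle_realization_degree[OF sub(1) circle] by simp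
        then have "{e \<in> edges H. v \<in> e} \<noteq> {}" by (metis card.empty)
        then show "v \<in> \<Union> (edges H)" by blast
      qed
    qed
    then show ?thesis by (simp add: row_graph_def edges)
  qed
  ultimately show ?thesis by (auto simp: cycle_rows_def)
qed

section \<open>Closed walks realizing the even edge sets with 5, 6, 8 or 9 edges\<close>

definition walk_pairs :: "nat list \<Rightarrow> (nat \<times> nat) list" where
  "walk_pairs w = zip w (tl w @ [hd w])"

text \<open>Rotating the outer and the inner vertices together is an automorphism, so few walks have
  to be listed. As 5 + i and i agree modulo 5, the same expression serves both kinds of
  vertex.\<close>

definition rotate_walk :: "nat \<Rightarrow> nat list \<Rightarrow> nat list" where
  "rotate_walk r w = map (\<lambda>x. if x < 5 then (x + r) mod 5 else 5 + (x + r) mod 5) w"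

text \<open>The walks are closed up by an edge from the last vertex to the first. The outer and the inner
  5-cycle are invariant under rotation and occur five times.\<close>

definition petersen_walks :: "nat list list" where
  "petersen_walks = [rotate_walk r w. w \<leftarrow>
     [[0, 1, 2, 3, 4], [0, 1, 2, 7, 5], [0, 1, 6, 8, 5], [5, 7, 9, 6, 8],
      [0, 1, 2, 3, 8, 5], [0, 1, 6, 9, 7, 5],
      [0, 1, 2, 3, 4, 9, 7, 5], [0, 1, 2, 7, 9, 6, 8, 5], [0, 1, 6, 8, 3, 2, 7, 5],
      [0, 1, 2, 3, 4, 9, 6, 8, 5], [0, 1, 2, 3, 8, 6, 9, 7, 5],
      [0, 1, 2, 7, 9, 4, 3, 8, 5], [0, 1, 6, 8, 3, 4, 9, 7, 5]], r \<leftarrow> [0..<5]]"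

definition joins :: "nat \<times> nat \<Rightarrow> nat \<times> nat \<Rightarrow> bool" where
  "joins e p \<longleftrightarrow> p = e \<or> p = (snd e, fst e)"

definition walk_row :: "nat list \<Rightarrow> bool list" where
  "walk_row w = map (\<lambda>e. list_ex (joins e) (walk_pairs w)) petersen_ends"

lemma set_walk_edges_closed:
  assumes "length xs \<ge> 2"
  shows "insert {last xs, hd xs} (set (walk_edges xs)) =
    (\<lambda>(a, b). {a, b}) ` set (zip xs (tl xs @ [hd xs]))"
proof -
  have zip: "zip ys (tl ys @ [y]) = zip ys (tl ys) @ [(last ys, y)]" if "ys \<noteq> []" for ys and y :: 'a
    using that by (induction ys rule: walk_edges.induct) auto
  have edges: "set (walk_edges ys) = (\<lambda>(a, b). {a, b}) ` set (zip ys (tl ys))" for ys :: "'a list"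
    by (induction ys rule: walk_edges.induct) auto
  have "xs \<noteq> []" using assms by auto
  then show ?thesis unfolding edges zip[OF \<open>xs \<noteq> []\<close>] by simp
qed

lemma length_petersen_ends: "length petersen_ends = 15"
  by (simp add: petersen_ends_def)

lemma petersen_walks_good:
  assumes "w \<in> set petersen_walks"
  shows "distinct w" "length w \<ge> 3" "\<forall>x\<in>set w. x < 10"
    "\<And>p. p \<in> set (walk_pairs w) \<Longrightarrow> \<exists>i<15. joins (petersen_ends ! i) p"
proof -
  have "list_all (\<lambda>w. distinct w \<and> length w \<ge> 3 \<and> list_all (\<lambda>x. x < 10) w \<and>
      list_all (\<lambda>p. list_ex (\<lambda>e. joins e p) petersen_ends) (walk_pairs w)) petersen_walks"
    by code_simp
  then have *: "distinct w \<and> length w \<ge> 3 \<and> (\<forall>x\<in>set w. x < 10) \<and>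
      (\<forall>p\<in>set (walk_pairs w). \<exists>e\<in>set petersen_ends. joins e p)"
    using assms by (simp add: list_all_iff list_ex_iff)
  then show "distinct w" "length w \<ge> 3" "\<forall>x\<in>set w. x < 10" by simp_all
  show "\<exists>i<15. joins (petersen_ends ! i) p" if "p \<in> set (walk_pairs w)" for p
    using * that by (metis in_set_conv_nth length_petersen_ends)
qed

lemma walk_row_circle:
  assumes "w \<in> set petersen_walks"
  shows "realization (row_graph (walk_row w)) homeomorphic sphere (0 :: real ^ 2) 1"
proof -
  note good = petersen_walks_good[OF assms]
  let ?xs = "map petersen_vertex_of w"
  have ne: "w \<noteq> []" using good(2) by auto
  have row_set: "row_set (walk_row w) = {i. i < 15 \<and> (\<exists>p\<in>set (walk_pairs w). joins (petersen_ends ! i) p)}"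
    by (auto simp: row_set_def walk_row_def list_ex_iff length_petersen_ends)
  have pairs: "zip ?xs (tl ?xs @ [hd ?xs]) = map (map_prod petersen_vertex_of petersen_vertex_of) (walk_pairs w)"
    using ne by (simp add: walk_pairs_def zip_map_map[symmetric] map_tl[symmetric] hd_map map_prod_def)
  have joins: "petersen_edge i = {petersen_vertex_of a, petersen_vertex_of b}" if "joins (petersen_ends ! i) (a, b)" for i a b
    using that by (cases "petersen_ends ! i") (auto simp: joins_def petersen_edge_def src_def tgt_def)
  have edges: "edges (row_graph (walk_row w)) = insert {last ?xs, hd ?xs} (set (walk_edges ?xs))"
  proof -
    have "insert {last ?xs, hd ?xs} (set (walk_edges ?xs)) =
        (\<lambda>(a, b). {petersen_vertex_of a, petersen_vertex_of b}) ` set (walk_pairs w)"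
      using set_walk_edges_closed[of ?xs] good(2) unfolding pairs by (simp add: image_image case_prod_beta)
    also have "\<dots> = petersen_edge ` row_set (walk_row w)"
    proof (intro equalityI subsetI)
      fix e assume "e \<in> (\<lambda>(a, b). {petersen_vertex_of a, petersen_vertex_of b}) ` set (walk_pairs w)"
      then obtain a b where ab: "(a, b) \<in> set (walk_pairs w)" "e = {petersen_vertex_of a, petersen_vertex_of b}" by auto
      then obtain i where "i < 15" "joins (petersen_ends ! i) (a, b)" using good(4) by blast
      then show "e \<in> petersen_edge ` row_set (walk_row w)"
        using ab joins[of i a b] by (auto simp: row_set intro!: image_eqI[of _ _ i])
    next
      fix e assume "e \<in> petersen_edge ` row_set (walk_row w)"
      then obtain i a b where "e = petersen_edge i" "(a, b) \<in> set (walk_pairs w)" "joins (petersen_ends ! i) (a, b)"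
        by (auto simp: row_set)
      then show "e \<in> (\<lambda>(a, b). {petersen_vertex_of a, petersen_vertex_of b}) ` set (walk_pairs w)"
        using joins[of i a b] by (auto intro!: image_eqI[of _ _ "(a, b)"])
    qed
    finally show ?thesis by (simp add: row_graph_def)
  qed
  have inj: "inj_on petersen_vertex_of (set w)"
    using bij_petersen_vertex_of good(3) by (auto simp: bij_betw_def intro: inj_on_subset)
  show ?thesis
  proof (rule closed_walk_homeomorphic_circle[OF _ _ edges])
    show "distinct ?xs" using good(1) inj by (simp add: distinct_map)
    show "3 \<le> length ?xs" using good(2) by simp
    have "verts (row_graph (walk_row w)) = \<Union> (edges (row_graph (walk_row w)))"
      by (simp add: row_graph_def)
    also have "\<dots> = set ?xs"
      unfolding edges using Union_walk_edges[of ?xs] good(2) ne by (auto simp: last_map hd_map)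
    finally show "verts (row_graph (walk_row w)) = set ?xs" .
  qed
qed

text \<open>Connectedness is not argued from the girth: evaluation finds each of these rows among
  the rows of \<open>petersen_walks\<close>, and such a walk is a circle. The counts are 12, 10, 15
  and 20.\<close>

lemma row_graph_cycle:
  assumes k: "k \<in> {5, 6, 8, 9}" and l: "l \<in> set (cycle_rows k)"
  shows "row_graph l \<in> cycles k petersen"
proof -
  have "list_all (\<lambda>l. length (filter id l) \<in> {5, 6, 8, 9} \<longrightarrow>
      List.member (map walk_row petersen_walks) l) even_rows"
    by code_simp
  then obtain w where "w \<in> set petersen_walks" "l = walk_row w"
    using k l by (auto simp: list_all_iff cycle_rows_def List.member_iff)
  then have circle: "realization (row_graph l) homeomorphic sphere (0 :: real ^ 2) 1"
    using walk_row_circle by blast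
  have row: "row_set l \<subseteq> {..<15}" by (auto simp: row_set_def)
  have "subgraph (row_graph l) petersen"
    using row petersen_vertex_of_ends_neq
    by (auto simp: subgraph_def simple_graph_def row_graph_def verts_petersen edges_petersen petersen_edge_def)
  moreover have "card (petersen_edge ` row_set l) = card (row_set l)"
    using inj_on_subset[OF inj_petersen_edge row] by (rule card_image)
  then have "card (edges (row_graph l)) = k"
    using l length_even_rows[of l] by (simp add: row_graph_def card_row_set cycle_rows_def)
  ultimately show ?thesis using circle by (simp add: cycles_def)
qed

lemma cycles_petersen:
  assumes "k \<in> {5, 6, 8, 9}"
  shows "cycles k petersen = row_graph ` set (cycle_rows k)"
  using cycle_petersen_row row_graph_cycle[OF assms] by blast


section \<open>Numbers of cycles through two edges\<close>

fun both :: "bool list \<Rightarrow> bool list \<Rightarrow> nat" where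
  "both (x # xs) (y # ys) = (if x \<and> y then Suc (both xs ys) else both xs ys)"
| "both _ _ = 0"

definition columns :: "bool list list \<Rightarrow> bool list list" where
  "columns L = map (\<lambda>i. map (\<lambda>l. l ! i) L) [0..<15]"

text \<open>The Gram matrix of the columns of the cycle-edge incidence matrix: an entry counts the
  \<open>k\<close>-cycles through two edges, a diagonal entry those through one.\<close>

definition through :: "nat \<Rightarrow> nat list list" where
  "through k = map (\<lambda>xs. map (both xs) (columns (cycle_rows k))) (columns (cycle_rows k))"

text \<open>For indices below 15 this says that the edges are disjoint and joined by a third edge.\<close>

definition near :: "nat \<Rightarrow> nat \<Rightarrow> bool" where
  "near i j \<longleftrightarrow> odd (through 5 ! i ! j)"

text \<open>Checks by evaluation read \<open>near\<close> off this table, instead of unfolding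
  \<open>near\<close> and thus counting the 5-cycles again for each pair.\<close>

definition near_table :: "bool list list" where
  "near_table = map (map odd) (through 5)"

lemma length_through:
  "length (through k) = 15" "i < 15 \<Longrightarrow> length (through k ! i) = 15"
  by (simp_all add: through_def columns_def)

lemma through_eq:
  assumes "i < 15" "j < 15"
  shows "through k ! i ! j = card {l \<in> set (cycle_rows k). l ! i \<and> l ! j}"
proof -
  have "both (map (\<lambda>l. l ! i) L) (map (\<lambda>l. l ! j) L) = length (filter (\<lambda>l. l ! i \<and> l ! j) L)"
    for L :: "bool list list"
    by (induction L) auto
  moreover have "distinct (cycle_rows k)"
    using distinct_even_rows by (simp add: cycle_rows_def)
  then have "length (filter (\<lambda>l. l ! i \<and> l ! j) (cycle_rows k)) =
      card {l \<in> set (cycle_rows k). l ! i \<and> l ! j}"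
    by (metis distinct_card distinct_filter set_filter)
  ultimately show ?thesis
    using assms by (simp add: through_def columns_def)
qed

lemma near_table_nth: "i < 15 \<Longrightarrow> j < 15 \<Longrightarrow> near_table ! i ! j \<longleftrightarrow> near i j"
  by (simp add: near_table_def near_def length_through)

lemma length_near_table:
  "length near_table = 15" "i < 15 \<Longrightarrow> length (near_table ! i) = 15"
  by (simp_all add: near_table_def length_through)

text \<open>An edge lies on eight 8-cycles, two distinct edges lie on four.\<close>

lemma four_dvd_8_cycles_through:
  assumes "i < 15" "j < 15"
  shows "4 dvd card {l \<in> set (cycle_rows 8). l ! i \<and> l ! j}"
proof -
  have "list_all (list_all (\<lambda>x. x = 4 \<or> x = 8)) (through 8)"
    by code_simp
  then have "through 8 ! i ! j = 4 \<or> through 8 ! i ! j = 8"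
    using assms by (simp add: list_all_length length_through)
  then show ?thesis
    unfolding through_eq[OF assms] by auto
qed

text \<open>Four 5-cycles pass through an edge, two through adjacent edges, one through near edges
  and none through any other pair. The tables for 6 and 9 agree with this one modulo 2.\<close>

lemma odd_cycles_through:
  assumes "k \<in> {5, 6, 9}" "i < 15" "j < 15"
  shows "odd (card {l \<in> set (cycle_rows k). l ! i \<and> l ! j}) \<longleftrightarrow> near i j"
proof -
  have "list_all2 (list_all2 (\<lambda>x y. odd x = odd y)) (through 6) (through 5)"
    by code_simp
  moreover have "list_all2 (list_all2 (\<lambda>x y. odd x = odd y)) (through 9) (through 5)"
    by code_simp
  moreover have "list_all2 (list_all2 (\<lambda>x y. odd x = odd y)) (through 5) (through 5)"
    by (simp add: list_all2_same)
  ultimately have "list_all2 (list_all2 (\<lambda>x y. odd x = odd y)) (through k) (through 5)"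
    using assms(1) by blast
  then have "odd (through k ! i ! j) \<longleftrightarrow> near i j"
    using assms(2,3) by (simp add: list_all2_conv_all_nth length_through near_def)
  then show ?thesis
    using assms(2,3) by (simp add: through_eq)
qed

text \<open>The ends of edge \<open>i\<close> meet no edge near \<open>i\<close>, and each of the
  other eight vertices meets exactly two. This is what makes the integer parts of the winding
  numbers cancel.\<close>

lemma even_near_inc:
  assumes "i < 15" "v < 10"
  shows "even (card {j. j < 15 \<and> near i j \<and> inc v j})"
proof -
  let ?c = "\<lambda>v. map (\<lambda>(x, y). v = x \<or> v = y) petersen_ends"
  have "list_all (\<lambda>c. list_all (\<lambda>r. even (both r c)) near_table)
      (map (\<lambda>v. map (\<lambda>(x, y). v = x \<or> v = y) petersen_ends) [0..<10])"
    by code_simp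
  then have "even (both (near_table ! i) (?c v))"
    using assms by (simp add: list_all_length length_near_table)
  also have "?c v = map (inc v) [0..<15]"
    by (rule nth_equalityI) (auto simp: length_petersen_ends inc_def src_def tgt_def case_prod_beta)
  also have "near_table ! i = map (near i) [0..<15]"
    using assms(1) by (intro nth_equalityI) (auto simp: length_near_table near_table_nth)
  also have "both (map (near i) L) (map (inc v) L) = length (filter (\<lambda>j. near i j \<and> inc v j) L)" for L
    by (induction L) auto
  also have "length (filter (\<lambda>j. near i j \<and> inc v j) [0..<15]) = card (set (filter (\<lambda>j. near i j \<and> inc v j) [0..<15]))"
    by (rule distinct_card[symmetric]) simp
  also have "set (filter (\<lambda>j. near i j \<and> inc v j) [0..<15]) = {j. j < 15 \<and> near i j \<and> inc v j}"
    by auto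
  finally show ?thesis .
qed

lemma near_sym: "i < 15 \<Longrightarrow> j < 15 \<Longrightarrow> near i j \<longleftrightarrow> near j i"
  by (simp add: near_def through_eq conj_commute)

text \<open>Ensures that an edge can have a winding number around the ends of an edge near
  it.\<close>

lemma near_not_inc:
  assumes "i < 15" "j < 15" "near i j"
  shows "\<not> inc (src j) i" "\<not> inc (tgt j) i"
proof -
  have "let T = near_table in list_all (\<lambda>i. list_all (\<lambda>j.
      T ! i ! j \<longrightarrow> \<not> inc (src j) i \<and> \<not> inc (tgt j) i) [0..<15]) [0..<15]"
    by code_simp
  then show "\<not> inc (src j) i" "\<not> inc (tgt j) i"
    using assms unfolding Let_def by (auto simp: list_all_upt near_table_nth)
qed

lemma not_near_self: "i < 15 \<Longrightarrow> \<not> near i i"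
  using near_not_inc(1)[of i i] by (auto simp: inc_def)

lemma near_disjoint: "i < 15 \<Longrightarrow> j < 15 \<Longrightarrow> near i j \<Longrightarrow> petersen_edge i \<inter> petersen_edge j = {}"
  using near_not_inc[of i j] by (auto simp: petersen_edge_def inc_def petersen_vertex_of_eq_iff ends_less)

section \<open>Crossings of near edges\<close>

text \<open>\<open>kappa i j\<close> has the parity of the number of crossings of the straight edges \<open>i\<close> and \<open>j\<close> when the
  ten vertices are placed in their order on a convex curve.\<close>

definition kappa :: "nat \<Rightarrow> nat \<Rightarrow> int" where
  "kappa i j = of_bool (src j < tgt i) - of_bool (src j < src i) + of_bool (tgt i < tgt j) - of_bool (src i < tgt j)"

definition near_pairs :: "(nat \<times> nat) set" where
  "near_pairs = {(i, j). i < j \<and> j < 15 \<and> near i j}"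

lemma finite_near_pairs: "finite near_pairs"
  by (rule finite_subset[of _ "{..<15} \<times> {..<15}"]) (auto simp: near_pairs_def)

lemma odd_sum_kappa: "odd (\<Sum>(i, j)\<in>near_pairs. kappa i j)"
proof -
  \<comment> \<open>Signs do not matter modulo 2, so the parity of \<open>kappa i j\<close> is the
    exclusive or of its four truth values, which can be evaluated.\<close>
  let ?P = "\<lambda>(i, j). i < j \<and> near_table ! i ! j \<and>
      ((src j < tgt i) \<noteq> (src j < src i)) \<noteq> ((tgt i < tgt j) \<noteq> (src i < tgt j))"
  have "let T = near_table in odd (length (filter (\<lambda>(i, j). i < j \<and> T ! i ! j \<and>
      ((src j < tgt i) \<noteq> (src j < src i)) \<noteq> ((tgt i < tgt j) \<noteq> (src i < tgt j)))
      (List.product [0..<15] [0..<15])))"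
    by code_simp
  then have "odd (length (filter ?P (List.product [0..<15] [0..<15])))"
    unfolding Let_def .
  also have "length (filter ?P (List.product [0..<15] [0..<15])) =
      card (Collect ?P \<inter> set (List.product [0..<15] [0..<15]))"
    by (intro distinct_length_filter distinct_product) simp_all
  also have "Collect ?P \<inter> set (List.product [0..<15] [0..<15]) =
      {e \<in> near_pairs. odd (case e of (i, j) \<Rightarrow> kappa i j)}"
    by (auto simp: near_pairs_def near_table_nth kappa_def)
  finally show ?thesis
    using finite_near_pairs by (simp add: even_sum_iff)
qed

section \<open>Points on edges of the Petersen graph\<close>

lemma simple_graph_row_graph: "simple_graph (row_graph l)"
  using petersen_vertex_of_ends_neq
  by (auto simp: simple_graph_def row_graph_def row_set_def petersen_edge_def)

definition edge_point :: "nat \<Rightarrow> real \<Rightarrow> real ^ petersen_vertex" where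
  "edge_point i = edge_path (petersen_vertex_of (src i)) (petersen_vertex_of (tgt i))"

lemma edge_point_eqD:
  assumes "edge_point i s = edge_point j t" "i < 15" "j < 15" "0 < s" "s < 1"
  shows "i = j" "s = t"
proof -
  have *: "petersen_vertex_of (src j) = petersen_vertex_of (src i) \<and> petersen_vertex_of (tgt j) = petersen_vertex_of (tgt i) \<and> t = s \<or>
      petersen_vertex_of (src j) = petersen_vertex_of (tgt i) \<and> petersen_vertex_of (tgt j) = petersen_vertex_of (src i) \<and> t = 1 - s"
    using edge_path_eq_cases[OF assms(1)[unfolded edge_point_def]] assms petersen_vertex_of_ends_neq by blast
  then have "petersen_edge i = petersen_edge j" by (auto simp: petersen_edge_def)
  then show "i = j" using inj_onD[OF inj_petersen_edge] assms by simp
  then show "s = t" using * petersen_vertex_of_ends_neq[OF assms(2)] by auto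
qed

text \<open>Points of disjoint edges have disjoint supports, and no point has empty support. Here
  both parameters may be end points, in contrast to \<open>edge_point_eqD\<close>.\<close>

lemma edge_point_neq_disjoint:
  assumes "petersen_edge i \<inter> petersen_edge j = {}" "s \<in> {0..1}" "t \<in> {0..1}"
  shows "edge_point i s \<noteq> edge_point j t"
proof
  assume eq: "edge_point i s = edge_point j t"
  have "edge_point i s \<in> convex hull (vertex_point ` petersen_edge i)"
    "edge_point j t \<in> convex hull (vertex_point ` petersen_edge j)"
    unfolding petersen_edge_def convex_hull_edge edge_point_def using assms(2,3) by blast+
  then have "edge_point i s $ z = 0" for z
    using edge_point_coords[of "edge_point i s" "petersen_vertex_of (src i)" "petersen_vertex_of (tgt i)" z]
      edge_point_coords[of "edge_point j t" "petersen_vertex_of (src j)" "petersen_vertex_of (tgt j)" z] assms(1) eq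
    unfolding petersen_edge_def[symmetric] by fastforce
  from this[of "petersen_vertex_of (src i)"] this[of "petersen_vertex_of (tgt i)"] show False
    using assms(2) by (auto simp: edge_point_def edge_path_nth split: if_splits)
qed

lemma edge_point_in_row_graph_iff:
  assumes "i < 15" "0 < s" "s < 1"
  shows "edge_point i s \<in> realization (row_graph l) \<longleftrightarrow> l ! i"
proof
  assume "l ! i"
  then have "petersen_edge i \<in> edges (row_graph l)"
    using assms(1) by (simp add: row_graph_def row_set_def)
  then show "edge_point i s \<in> realization (row_graph l)"
    unfolding edge_point_def using assms by (intro realization_edge_pathI) (auto simp: petersen_edge_def)
next
  have ne: "petersen_vertex_of (src i) \<noteq> petersen_vertex_of (tgt i)" by (rule petersen_vertex_of_ends_neq[OF assms(1)])
  assume "edge_point i s \<in> realization (row_graph l)"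
  with simple_graph_row_graph show "l ! i"
  proof (cases rule: realization_cases)
    case (1 v)
    then show ?thesis
      using vertex_point_neq_edge_path[OF ne assms(2,3)] by (simp add: edge_point_def) metis
  next
    case (2 x y t)
    then have "{x, y} = petersen_edge i"
      using edge_path_eq_cases[of "petersen_vertex_of (src i)" "petersen_vertex_of (tgt i)" s x y t] ne assms
      by (auto simp: edge_point_def petersen_edge_def)
    moreover obtain j where "j < 15" "l ! j" "{x, y} = petersen_edge j"
      using 2(1) by (auto simp: row_graph_def row_set_def)
    ultimately show ?thesis using inj_onD[OF inj_petersen_edge, of i j] assms(1) by simp
  qed
qed

section \<open>Transversality in the complex plane\<close>

definition plane_to_complex :: "real ^ 2 \<Rightarrow> complex" where
  "plane_to_complex p = Complex (p $ 1) (p $ 2)"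

lemma bounded_linear_plane_to_complex: "bounded_linear plane_to_complex"
  by (rule linear_conv_bounded_linear[THEN iffD1])
     (auto intro!: linearI simp: plane_to_complex_def complex_eq_iff)

lemma plane_to_complex_eq_iff: "plane_to_complex p = plane_to_complex q \<longleftrightarrow> p = q"
  by (auto simp: plane_to_complex_def vec_eq_iff forall_2)

lemma independent_plane_to_complex:
  assumes "span {w, z :: real ^ 2} = UNIV"
  shows "Im (cnj (plane_to_complex w) * plane_to_complex z) \<noteq> 0"
proof
  assume "Im (cnj (plane_to_complex w) * plane_to_complex z) = 0"
  then have det: "w $ 1 * z $ 2 = w $ 2 * z $ 1"
    by (simp add: plane_to_complex_def algebra_simps)
  have "u = 0" if "u \<bullet> w = 0" "u \<bullet> z = 0" for u :: "real ^ 2"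
  proof -
    have "span {w, z} \<subseteq> {x. u \<bullet> x = 0}"
      using that by (intro span_minimal subspace_hyperplane) auto
    then have "u \<bullet> u = 0" using assms by blast
    then show "u = 0" by simp
  qed
  note * = this
  \<comment> \<open>When the determinant vanishes, each of \<open>w\<close>, \<open>z\<close> turned
    by a right angle is orthogonal to both. Hence both are zero and could not span the
    plane.\<close>
  have "vector [- (w $ 2), w $ 1] = (0 :: real ^ 2)" "vector [- (z $ 2), z $ 1] = (0 :: real ^ 2)"
    by (intro *; use det in \<open>simp add: inner_vec_def sum_2 algebra_simps\<close>)+
  then have "w = 0" "z = 0"
    by (auto simp: vec_eq_iff forall_2)
  then have "vector [1, 0] = (0 :: real ^ 2)" by (intro *) auto
  then show False by (auto simp: vec_eq_iff forall_2)
qed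

lemma card_Collect_in_eq_sum:
  assumes "finite M" "finite S"
  shows "card {p \<in> M. g p \<in> S} = (\<Sum>s\<in>S. card {p \<in> M. g p = s})"
proof -
  have "(\<Sum>s\<in>S. \<Sum>p\<in>{p. p \<in> {p \<in> M. g p \<in> S} \<and> g p = s}. 1) = (\<Sum>p\<in>{p \<in> M. g p \<in> S}. 1 :: nat)"
    using assms by (intro sum.group) auto
  moreover have "{p. p \<in> {p \<in> M. g p \<in> S} \<and> g p = s} = {p \<in> M. g p = s}" if "s \<in> S" for s
    using that by auto
  ultimately show ?thesis by simp
qed

section \<open>Double points and the edges they lie on\<close>

locale petersen_immersion =
  fixes f :: "real ^ petersen_vertex \<Rightarrow> real ^ 2"
  assumes generic: "plane_generic_immersion petersen f"
begin

definition double_points :: "(real ^ 2) set" where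
  "double_points = multiple_points f (realization petersen)"

definition edge_curve :: "nat \<Rightarrow> real \<Rightarrow> complex" where
  "edge_curve i t = plane_to_complex (f (edge_point i t))"

definition vertex_image :: "nat \<Rightarrow> complex" where
  "vertex_image v = plane_to_complex (f (vertex_point (petersen_vertex_of v)))"

lemma finite_double_points: "finite double_points"
  using generic by (simp add: plane_generic_immersion_def double_points_def)

lemma edge_point_in_realization: "i < 15 \<Longrightarrow> t \<in> {0..1} \<Longrightarrow> edge_point i t \<in> realization petersen"
  unfolding edge_point_def
  by (intro realization_edge_pathI) (auto simp: edges_petersen petersen_edge_def)

lemma vertex_in_realization: "vertex_point v \<in> realization petersen"
  by (simp add: realization_def verts_petersen)

lemma continuous_edge_curve: "i < 15 \<Longrightarrow> continuous_on {0..1} (edge_curve i)"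
proof -
  assume i: "i < 15"
  have "continuous_on (realization petersen) f"
    using generic by (simp add: plane_generic_immersion_def plane_immersion_def)
  then have "continuous_on {0..1} (\<lambda>t. f (edge_point i t))"
    by (rule continuous_on_compose2)
       (use edge_point_in_realization[OF i] in \<open>auto simp: edge_point_def linepath_def intro!: continuous_intros\<close>)
  then show ?thesis
    unfolding edge_curve_def by (rule bounded_linear.continuous_on[OF bounded_linear_plane_to_complex])
qed

text \<open>\<open>edge_velocity\<close> may traverse the edge from either end, whereas
  \<open>edge_curve\<close> has a fixed orientation; \<sigma> records whether they agree.\<close>

lemma edge_velocity_edge_curve:
  assumes "edge_velocity petersen f a w"
  obtains i s \<sigma> where "i < 15" "0 < s" "s < 1" "a = edge_point i s" "\<sigma> = 1 \<or> \<sigma> = -1"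
    "(edge_curve i has_vector_derivative of_real \<sigma> * plane_to_complex w) (at s)"
proof -
  obtain x y t where xy: "{x, y} \<in> edges petersen" and t: "0 < t" "t < 1" "a = edge_path x y t"
    and der: "((f \<circ> edge_path x y) has_vector_derivative w) (at t)"
    using assms by (auto simp: edge_velocity_def)
  obtain i where i: "i < 15" "{x, y} = {petersen_vertex_of (src i), petersen_vertex_of (tgt i)}"
    using xy by (auto simp: edges_petersen petersen_edge_def)
  note push = bounded_linear.has_vector_derivative[OF bounded_linear_plane_to_complex]
  from i(2) consider "x = petersen_vertex_of (src i)" "y = petersen_vertex_of (tgt i)"
    | "x = petersen_vertex_of (tgt i)" "y = petersen_vertex_of (src i)"
    by (auto simp: doubleton_eq_iff)
  then show ?thesis
  proof cases
    case 1
    then have "edge_curve i = (\<lambda>t. plane_to_complex ((f \<circ> edge_path x y) t))"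
      by (auto simp: edge_curve_def edge_point_def)
    then show ?thesis
      using that[of i t 1] i t push[OF der] 1 by (simp add: edge_point_def)
  next
    case 2
    then have pt: "edge_point i s = edge_path x y (1 - s)" for s
      using edge_path_reverse[of y x s] by (simp add: edge_point_def)
    have "((\<lambda>s. 1 - s) has_vector_derivative -1) (at (1 - t))"
      by (auto intro!: derivative_eq_intros)
    then have "((f \<circ> edge_path x y) \<circ> (\<lambda>s. 1 - s) has_vector_derivative (-1) *\<^sub>R w) (at (1 - t))"
      by (rule vector_diff_chain_at) (use der in simp)
    moreover have "edge_curve i = (\<lambda>s. plane_to_complex (((f \<circ> edge_path x y) \<circ> (\<lambda>s. 1 - s)) s))"
      by (simp add: edge_curve_def pt fun_eq_iff)
    ultimately have "(edge_curve i has_vector_derivative plane_to_complex ((-1) *\<^sub>R w)) (at (1 - t))"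
      using push by metis
    moreover have "plane_to_complex ((-1) *\<^sub>R w) = of_real (-1) * plane_to_complex w"
      by (simp add: plane_to_complex_def complex_eq_iff)
    ultimately show ?thesis
      using that[of i "1 - t" "-1"] i t pt[of "1 - t"] by simp
  qed
qed

text \<open>The condition \<open>i \<le> j\<close> orders the two branches, so that a crossing
  belongs to one pair of edges; \<open>i = j\<close> is a self-crossing of an edge.\<close>

definition crossing_at :: "real ^ 2 \<Rightarrow> nat \<Rightarrow> nat \<Rightarrow> real \<Rightarrow> real \<Rightarrow> bool" where
  "crossing_at p i j s t \<longleftrightarrow> i \<le> j \<and> i < 15 \<and> j < 15 \<and> s \<in> {0<..<1} \<and> t \<in> {0<..<1} \<and>
    {q \<in> realization petersen. f q = p} = {edge_point i s, edge_point j t} \<and>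
    edge_point i s \<noteq> edge_point j t \<and>
    (\<exists>w z. (edge_curve i has_vector_derivative w) (at s) \<and>
      (edge_curve j has_vector_derivative z) (at t) \<and> Im (cnj w * z) \<noteq> 0)"

lemma double_points_crossing_at:
  assumes "p \<in> double_points"
  shows "\<exists>i j s t. crossing_at p i j s t"
proof -
  obtain a b w z where ab: "a \<noteq> b" "{q \<in> realization petersen. f q = p} = {a, b}"
    and vel: "edge_velocity petersen f a w" "edge_velocity petersen f b z" and span: "span {w, z} = UNIV"
    using assms generic by (auto simp: plane_generic_immersion_def double_points_def transversal_double_point_def)
  obtain i s \<sigma> where i: "i < 15" "0 < s" "s < 1" "a = edge_point i s" "\<sigma> = 1 \<or> \<sigma> = -1"
    "(edge_curve i has_vector_derivative of_real \<sigma> * plane_to_complex w) (at s)"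
    using edge_velocity_edge_curve[OF vel(1)] .
  obtain j t \<tau> where j: "j < 15" "0 < t" "t < 1" "b = edge_point j t" "\<tau> = 1 \<or> \<tau> = -1"
    "(edge_curve j has_vector_derivative of_real \<tau> * plane_to_complex z) (at t)"
    using edge_velocity_edge_curve[OF vel(2)] .
  let ?w = "of_real \<sigma> * plane_to_complex w" and ?z = "of_real \<tau> * plane_to_complex z"
  have "Im (cnj ?w * ?z) \<noteq> 0" "Im (cnj ?z * ?w) \<noteq> 0"
    using independent_plane_to_complex[OF span] i(5) j(5) by (auto simp: algebra_simps)
  then have "\<exists>w z. (edge_curve i has_vector_derivative w) (at s) \<and>
      (edge_curve j has_vector_derivative z) (at t) \<and> Im (cnj w * z) \<noteq> 0"
    "\<exists>w z. (edge_curve j has_vector_derivative w) (at t) \<and>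
      (edge_curve i has_vector_derivative z) (at s) \<and> Im (cnj w * z) \<noteq> 0"
    using i(6) j(6) by blast+
  then have "i \<le> j \<Longrightarrow> crossing_at p i j s t" "j \<le> i \<Longrightarrow> crossing_at p j i t s"
    unfolding crossing_at_def using ab i(1-4) j(1-4) by (simp_all add: insert_commute)
  then show ?thesis by (metis nat_le_linear)
qed

definition edge1 :: "real ^ 2 \<Rightarrow> nat" where
  "edge1 p = (SOME i. \<exists>j s t. crossing_at p i j s t)"

text \<open>Chosen after \<open>edge1\<close>, so that both edges come from the same pair of
  branches.\<close>

definition edge2 :: "real ^ 2 \<Rightarrow> nat" where
  "edge2 p = (SOME j. \<exists>s t. crossing_at p (edge1 p) j s t)"

lemma double_points_crossing_at_edges:
  assumes "p \<in> double_points"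
  obtains s t where "crossing_at p (edge1 p) (edge2 p) s t"
proof -
  have "\<exists>j s t. crossing_at p (edge1 p) j s t"
    unfolding edge1_def by (rule someI_ex[OF double_points_crossing_at[OF assms]])
  then have "\<exists>s t. crossing_at p (edge1 p) (edge2 p) s t"
    unfolding edge2_def by (rule someI_ex)
  then show ?thesis using that by blast
qed

lemma double_pointsI:
  assumes "a \<in> realization petersen" "b \<in> realization petersen" "a \<noteq> b" "f a = f b"
  shows "f a \<in> double_points"
  using assms unfolding double_points_def multiple_points_def by force

lemma vertex_not_double_point: "f (vertex_point v) \<notin> double_points"
proof
  assume "f (vertex_point v) \<in> double_points"
  then obtain i j s t where c: "crossing_at (f (vertex_point v)) i j s t"
    using double_points_crossing_at by blast
  then have "vertex_point v \<in> {edge_point i s, edge_point j t}"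
    using vertex_in_realization[of v] by (auto simp: crossing_at_def)
  then show False
    using c vertex_point_neq_edge_path[OF petersen_vertex_of_ends_neq]
    by (auto simp: crossing_at_def edge_point_def)
qed

text \<open>Both preimages of a crossing are interior points of edges, and such a point lies in a
  subgraph only together with its edge.\<close>

lemma crossings_row_graph: "crossings f (row_graph l) = card {p \<in> double_points. l ! edge1 p \<and> l ! edge2 p}"
proof -
  have sub: "realization (row_graph l) \<subseteq> realization petersen"
    by (auto simp: realization_def row_graph_def verts_petersen edges_petersen row_set_def)
  have "p \<in> multiple_points f (realization (row_graph l)) \<longleftrightarrow> p \<in> double_points \<and> l ! edge1 p \<and> l ! edge2 p" for p
  proof
    assume "p \<in> multiple_points f (realization (row_graph l))"
    then obtain a b where ab: "a \<in> realization (row_graph l)" "b \<in> realization (row_graph l)"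
      "a \<noteq> b" "f a = p" "f b = p" by (auto simp: multiple_points_def)
    then have double_points: "p \<in> double_points" using double_pointsI[of a b] sub by auto
    then obtain s t where c: "crossing_at p (edge1 p) (edge2 p) s t" using double_points_crossing_at_edges by blast
    have "{a, b} \<subseteq> {edge_point (edge1 p) s, edge_point (edge2 p) t}"
      using c ab sub by (auto simp: crossing_at_def)
    then have "{edge_point (edge1 p) s, edge_point (edge2 p) t} = {a, b}"
      using ab(3) by auto
    then have "{edge_point (edge1 p) s, edge_point (edge2 p) t} \<subseteq> realization (row_graph l)"
      using ab(1,2) by simp
    then have "edge_point (edge1 p) s \<in> realization (row_graph l)"
      "edge_point (edge2 p) t \<in> realization (row_graph l)"
      by simp_all
    then show "p \<in> double_points \<and> l ! edge1 p \<and> l ! edge2 p"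
      using double_points c by (simp add: crossing_at_def edge_point_in_row_graph_iff)
  next
    assume p: "p \<in> double_points \<and> l ! edge1 p \<and> l ! edge2 p"
    then obtain s t where c: "crossing_at p (edge1 p) (edge2 p) s t" using double_points_crossing_at_edges by blast
    then have "edge_point (edge1 p) s \<in> realization (row_graph l)"
      "edge_point (edge2 p) t \<in> realization (row_graph l)"
      using p by (simp_all add: crossing_at_def edge_point_in_row_graph_iff)
    moreover have "f (edge_point (edge1 p) s) = p" "f (edge_point (edge2 p) t) = p"
      "edge_point (edge1 p) s \<noteq> edge_point (edge2 p) t"
      using c by (auto simp: crossing_at_def)
    ultimately show "p \<in> multiple_points f (realization (row_graph l))"
      unfolding multiple_points_def by blast
  qed
  then have "multiple_points f (realization (row_graph l)) = {p \<in> double_points. l ! edge1 p \<and> l ! edge2 p}"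
    by blast
  then show ?thesis by (simp add: crossings_def)
qed

section \<open>Winding numbers of edges around vertices\<close>

lemma edge_curve_ends: "edge_curve i 0 = vertex_image (src i)" "edge_curve i 1 = vertex_image (tgt i)"
  by (simp_all add: edge_curve_def vertex_image_def edge_point_def linepath_0' linepath_1')

lemma vertex_image_eq_iff:
  assumes "u < 10" "v < 10"
  shows "vertex_image u = vertex_image v \<longleftrightarrow> u = v"
proof
  assume "vertex_image u = vertex_image v"
  then have "f (vertex_point (petersen_vertex_of u)) = f (vertex_point (petersen_vertex_of v))"
    by (simp add: vertex_image_def plane_to_complex_eq_iff)
  then have "vertex_point (petersen_vertex_of u) = (vertex_point (petersen_vertex_of v) :: real ^ petersen_vertex)"
    using double_pointsI vertex_in_realization vertex_not_double_point by metis
  then show "u = v"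
    using assms by (simp add: axis_eq_axis petersen_vertex_of_eq_iff)
qed simp

lemma edge_curve_neq_vertex_image:
  assumes "i < 15" "v < 10" "\<not> inc v i" "t \<in> {0..1}"
  shows "edge_curve i t \<noteq> vertex_image v"
proof
  assume "edge_curve i t = vertex_image v"
  then have eq: "f (vertex_point (petersen_vertex_of v)) = f (edge_point i t)"
    by (simp add: edge_curve_def vertex_image_def plane_to_complex_eq_iff)
  have "edge_point i t $ petersen_vertex_of v = 0"
    using assms by (simp add: edge_point_def edge_path_nth petersen_vertex_of_eq_iff ends_less inc_def)
  then have "vertex_point (petersen_vertex_of v) \<noteq> edge_point i t"
    by (metis vertex_point_nth zero_neq_one)
  then show False
    using double_pointsI[OF vertex_in_realization edge_point_in_realization[OF assms(1,4)] _ eq] vertex_not_double_point by blast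
qed

text \<open>A logarithm, divided by \<open>2 \<pi> \<i>\<close>, of the vector from vertex \<open>v\<close> to vertex \<open>u\<close>. The branches are
  coupled so that reversing the vector always adds one half for \<open>u < v\<close>.\<close>

definition direction :: "nat \<Rightarrow> nat \<Rightarrow> complex" where
  "direction u v =
     (if u < v then Ln (vertex_image u - vertex_image v) / (2 * pi * \<i>)
      else Ln (vertex_image v - vertex_image u) / (2 * pi * \<i>) + 1 / 2)"

lemma exp_direction:
  assumes "u < 10" "v < 10" "u \<noteq> v"
  shows "exp (2 * pi * \<i> * direction u v) = vertex_image u - vertex_image v"
proof -
  have ne: "vertex_image u \<noteq> vertex_image v" using assms by (simp add: vertex_image_eq_iff)
  show ?thesis
  proof (cases "u < v")
    case True
    then show ?thesis using ne by (simp add: direction_def)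
  next
    case False
    then have "2 * pi * \<i> * direction u v = Ln (vertex_image v - vertex_image u) + pi * \<i>"
      by (simp add: direction_def field_simps)
    then show ?thesis using ne by (simp add: exp_add)
  qed
qed

text \<open>Opposite vectors share one value of \<open>Ln\<close>, so the difference is known
  exactly and not just up to an integer. It depends only on the numbering of the vertices, not on
  \<open>f\<close>.\<close>

lemma direction_diff:
  "u \<noteq> v \<Longrightarrow> direction u v - direction v u = of_bool (v < u) - 1 / 2"
  by (auto simp: direction_def)

text \<open>\<open>exp\<close> of \<open>2 * pi * \<i>\<close> times the winding number is the
  quotient of the vectors from \<open>v\<close> to the two ends of the edge, so the two sides can
  differ only by an integer.\<close>

lemma winding_number_edge_curve:
  assumes "i < 15" "v < 10" "\<not> inc v i"
  shows "\<exists>n::int. winding_number (edge_curve i) (vertex_image v) =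
    direction (tgt i) v - direction (src i) v + of_int n"
proof -
  let ?W = "winding_number (edge_curve i) (vertex_image v)"
  have path: "path (edge_curve i)"
    using continuous_edge_curve[OF assms(1)] by (simp add: path_def)
  have "vertex_image v \<notin> path_image (edge_curve i)"
    using edge_curve_neq_vertex_image[OF assms] by (force simp: path_image_def)
  from winding_number_exp_2pi[OF path this]
  have "vertex_image (tgt i) - vertex_image v = exp (2 * pi * \<i> * ?W) * (vertex_image (src i) - vertex_image v)"
    by (simp only: pathstart_def pathfinish_def edge_curve_ends)
  moreover have "tgt i \<noteq> v" "src i \<noteq> v"
    using assms(3) by (auto simp: inc_def)
  ultimately have "exp (2 * pi * \<i> * direction (tgt i) v) = exp (2 * pi * \<i> * ?W) * exp (2 * pi * \<i> * direction (src i) v)"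
    using exp_direction[of "tgt i" v] exp_direction[of "src i" v] assms ends_less by simp
  then have "exp (2 * pi * \<i> * (?W + direction (src i) v)) = exp (2 * pi * \<i> * direction (tgt i) v)"
    by (simp add: exp_add distrib_left)
  then obtain n :: int where
    "2 * pi * \<i> * (?W + direction (src i) v) = 2 * pi * \<i> * direction (tgt i) v + (of_int (2 * n) * pi) * \<i>"
    unfolding exp_eq by blast
  then have "2 * pi * \<i> * (?W + direction (src i) v) = 2 * pi * \<i> * (direction (tgt i) v + of_int n)"
    by (simp add: algebra_simps)
  then have "?W + direction (src i) v = direction (tgt i) v + of_int n"
    by simp
  then show ?thesis
    by (intro exI[of _ n]) (simp add: algebra_simps)
qed

text \<open>The part of the winding number that depends on the course of the edge and not only on
  the images of its ends and of \<open>v\<close>.\<close>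

definition turns :: "nat \<Rightarrow> nat \<Rightarrow> int" where
  "turns i v = (SOME n. winding_number (edge_curve i) (vertex_image v) =
    direction (tgt i) v - direction (src i) v + of_int n)"

lemma winding_number_turns:
  assumes "i < 15" "v < 10" "\<not> inc v i"
  shows "winding_number (edge_curve i) (vertex_image v) =
    direction (tgt i) v - direction (src i) v + of_int (turns i v)"
  unfolding turns_def by (rule someI_ex[OF winding_number_edge_curve[OF assms]])

text \<open>Points of disjoint edges are distinct even at the ends, so every coincidence of the two
  curves is a double point. It has only two preimages, and \<open>i < j\<close> decides which of
  them belongs to \<open>edge1\<close>.\<close>

lemma near_crossings_bij:
  assumes ij: "(i, j) \<in> near_pairs"
  defines "Z \<equiv> {(s, t). s \<in> {0..1} \<and> t \<in> {0..1} \<and> edge_curve i s = edge_curve j t}"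
  shows "\<And>s t. (s, t) \<in> Z \<Longrightarrow> crossing_at (f (edge_point i s)) i j s t"
    and "bij_betw (\<lambda>(s, t). f (edge_point i s)) Z {p \<in> double_points. (edge1 p, edge2 p) = (i, j)}"
proof -
  have less: "i < 15" "j < 15" "i < j" and near: "near i j"
    using ij by (auto simp: near_pairs_def)
  have Z: "f (edge_point i s) \<in> double_points \<and> edge1 (f (edge_point i s)) = i \<and> edge2 (f (edge_point i s)) = j \<and>
      crossing_at (f (edge_point i s)) i j s t" if st: "(s, t) \<in> Z" for s t
  proof -
    let ?p = "f (edge_point i s)"
    have st': "s \<in> {0..1}" "t \<in> {0..1}" and eq: "?p = f (edge_point j t)"
      using st by (auto simp: Z_def edge_curve_def plane_to_complex_eq_iff)
    have ne: "edge_point i s \<noteq> edge_point j t"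
      using edge_point_neq_disjoint[OF near_disjoint[OF less(1,2) near] st'] .
    have double_points: "?p \<in> double_points"
      using double_pointsI[OF edge_point_in_realization edge_point_in_realization ne eq] less st' by blast
    then obtain s' t' where c: "crossing_at ?p (edge1 ?p) (edge2 ?p) s' t'"
      using double_points_crossing_at_edges by blast
    let ?e1 = "edge_point (edge1 ?p) s'" and ?e2 = "edge_point (edge2 ?p) t'"
    have "edge_point i s \<in> {?e1, ?e2}" "edge_point j t \<in> {?e1, ?e2}"
      using c edge_point_in_realization less st' eq by (auto simp: crossing_at_def)
    then consider "?e1 = edge_point i s" "?e2 = edge_point j t"
      | "?e1 = edge_point j t" "?e2 = edge_point i s"
      using ne by auto
    then have "edge1 ?p = i \<and> edge2 ?p = j \<and> s' = s \<and> t' = t"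
    proof cases
      case 1
      then show ?thesis using c less edge_point_eqD[OF 1(1)] edge_point_eqD[OF 1(2)]
        by (simp add: crossing_at_def)
    next
      \<comment> \<open>Impossible: \<open>edge1\<close> would exceed \<open>edge2\<close>.\<close>
      case 2
      then have "edge1 ?p = j" "edge2 ?p = i"
        using c less edge_point_eqD[OF 2(1)] edge_point_eqD[OF 2(2)] by (simp_all add: crossing_at_def)
      then show ?thesis using c less by (simp add: crossing_at_def)
    qed
    then show ?thesis using double_points c by simp
  qed
  then show "\<And>s t. (s, t) \<in> Z \<Longrightarrow> crossing_at (f (edge_point i s)) i j s t" by blast
  show "bij_betw (\<lambda>(s, t). f (edge_point i s)) Z {p \<in> double_points. (edge1 p, edge2 p) = (i, j)}"
  proof (rule bij_betwI')
    fix x y assume xy: "x \<in> Z" "y \<in> Z"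
    obtain s t s' t' where st: "x = (s, t)" "y = (s', t')" by (cases x; cases y)
    show "((case x of (s, t) \<Rightarrow> f (edge_point i s)) = (case y of (s, t) \<Rightarrow> f (edge_point i s))) = (x = y)"
    proof
      assume "(case x of (s, t) \<Rightarrow> f (edge_point i s)) = (case y of (s, t) \<Rightarrow> f (edge_point i s))"
      then have eq: "f (edge_point i s) = f (edge_point i s')" using st by simp
      have c: "crossing_at (f (edge_point i s)) i j s t" "crossing_at (f (edge_point i s)) i j s' t'"
        using Z[of s t] Z[of s' t'] xy st eq by simp_all
      then have "{edge_point i s, edge_point j t} = {edge_point i s', edge_point j t'}"
        by (simp add: crossing_at_def)
      then have "edge_point i s = edge_point i s' \<and> edge_point j t = edge_point j t' \<or>
          edge_point i s = edge_point j t'"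
        by (auto simp: doubleton_eq_iff)
      then show "x = y"
        using c less st edge_point_eqD[of i s i s'] edge_point_eqD[of j t j t'] edge_point_eqD[of i s j t']
        by (auto simp: crossing_at_def)
    qed simp
  next
    fix x assume "x \<in> Z"
    then show "(case x of (s, t) \<Rightarrow> f (edge_point i s)) \<in> {p \<in> double_points. (edge1 p, edge2 p) = (i, j)}"
      using Z by (cases x) simp
  next
    fix p assume "p \<in> {p \<in> double_points. (edge1 p, edge2 p) = (i, j)}"
    then obtain s t where c: "crossing_at p i j s t"
      using double_points_crossing_at_edges[of p] by auto
    then have eq: "f (edge_point i s) = p" "f (edge_point j t) = p"
      by (auto simp: crossing_at_def)
    then have "(s, t) \<in> Z"
      using c by (simp add: Z_def crossing_at_def edge_curve_def)
    then show "\<exists>x\<in>Z. p = (case x of (s, t) \<Rightarrow> f (edge_point i s))"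
      using eq by (intro bexI[of _ "(s, t)"]) simp_all
  qed
qed

lemma near_crossings_parity:
  assumes ij: "(i, j) \<in> near_pairs"
  shows "even (card {p \<in> double_points. (edge1 p, edge2 p) = (i, j)}) \<longleftrightarrow>
    even (kappa i j + (turns i (src j) + turns j (tgt i) - turns i (tgt j) - turns j (src i)))"
proof -
  let ?Z = "{(s, t). s \<in> {0..1} \<and> t \<in> {0..1} \<and> edge_curve i s = edge_curve j t}"
  have less: "i < 15" "j < 15" and near: "near i j"
    using ij by (auto simp: near_pairs_def)
  note bij = near_crossings_bij[OF ij]
  have card: "card ?Z = card {p \<in> double_points. (edge1 p, edge2 p) = (i, j)}"
    by (rule bij_betw_same_card[OF bij(2)])
  have "finite {p \<in> double_points. (edge1 p, edge2 p) = (i, j)}" using finite_double_points by simp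
  then have fin: "finite ?Z" using bij_betw_finite[OF bij(2)] by simp
  have "\<exists>n::int. winding_number (edge_curve i) (edge_curve j 0) + winding_number (edge_curve j) (edge_curve i 1)
      - winding_number (edge_curve i) (edge_curve j 1) - winding_number (edge_curve j) (edge_curve i 0) = of_int n \<and>
      (even n \<longleftrightarrow> even (card ?Z))"
  proof (rule crossing_parity)
    show "?Z \<subseteq> {0<..<1} \<times> {0<..<1}"
      using bij(1) by (auto simp: crossing_at_def)
    show "\<exists>\<alpha> \<beta>. (edge_curve i has_vector_derivative \<alpha>) (at s) \<and>
        (edge_curve j has_vector_derivative \<beta>) (at t) \<and> Im (cnj \<alpha> * \<beta>) \<noteq> 0" if "(s, t) \<in> ?Z" for s t
      using bij(1)[OF that] by (simp add: crossing_at_def)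
  qed (use less fin continuous_edge_curve in auto)
  then obtain n :: int where n: "even n \<longleftrightarrow> even (card ?Z)"
    and wn: "winding_number (edge_curve i) (edge_curve j 0) + winding_number (edge_curve j) (edge_curve i 1)
      - winding_number (edge_curve i) (edge_curve j 1) - winding_number (edge_curve j) (edge_curve i 0) = of_int n"
    by blast
  have inc: "\<not> inc (src j) i" "\<not> inc (tgt j) i" "\<not> inc (src i) j" "\<not> inc (tgt i) j"
    using near_not_inc[of i j] near_not_inc[of j i] near near_sym less by blast+
  then have ne: "tgt i \<noteq> src j" "src i \<noteq> src j" "tgt j \<noteq> tgt i" "tgt j \<noteq> src i"
    by (auto simp: inc_def)
  \<comment> \<open>Each end of \<open>i\<close> is seen from each end of \<open>j\<close> and vice
    versa, with opposite signs. The four constants 1/2 of \<open>direction_diff\<close> then cancel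
    and leave \<open>kappa i j\<close>.\<close>
  have "of_int n = (direction (tgt i) (src j) - direction (src j) (tgt i))
      - (direction (src i) (src j) - direction (src j) (src i))
      + (direction (tgt j) (tgt i) - direction (tgt i) (tgt j))
      - (direction (tgt j) (src i) - direction (src i) (tgt j))
      + of_int (turns i (src j) + turns j (tgt i) - turns i (tgt j) - turns j (src i))"
    unfolding wn[symmetric] edge_curve_ends
    using winding_number_turns less ends_less inc by simp
  also have "\<dots> = of_int (kappa i j + (turns i (src j) + turns j (tgt i) - turns i (tgt j) - turns j (src i)))"
    unfolding direction_diff[OF ne(1)] direction_diff[OF ne(2)] direction_diff[OF ne(3)] direction_diff[OF ne(4)]
    by (simp add: kappa_def)
  finally have "n = kappa i j + (turns i (src j) + turns j (tgt i) - turns i (tgt j) - turns j (src i))"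
    by (simp only: of_int_eq_iff)
  then show ?thesis using n card by simp
qed

text \<open>Each \<open>turns i v\<close> occurs an even number of times: the edges near \<open>i\<close> form an 8-cycle.\<close>

lemma even_sum_turns:
  "even (\<Sum>(i, j)\<in>near_pairs. turns i (src j) + turns j (tgt i) - turns i (tgt j) - turns j (src i))"
proof -
  \<comment> \<open>Modulo 2 the signs disappear, and a summand becomes
    \<open>g i j + g j i\<close>.\<close>
  define g where "g i j = turns i (src j) + turns i (tgt j)" for i j
  define N where "N i = {j. j < 15 \<and> near i j}" for i
  note fin = finite_near_pairs
  have g: "g i j = (\<Sum>v<10. of_bool (inc v j) * turns i v)" if "j < 15" for i j
  proof -
    have "(\<Sum>v<10. of_bool (inc v j) * turns i v) = (\<Sum>v\<in>{src j, tgt j}. turns i v)"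
      using ends_less[OF that] by (intro sum.mono_neutral_cong_right) (auto simp: inc_def)
    then show ?thesis using src_neq_tgt[OF that] by (simp add: g_def)
  qed
  have even_g: "even (\<Sum>j\<in>N i. g i j)" if i: "i < 15" for i
  proof -
    have "(\<Sum>j\<in>N i. g i j) = (\<Sum>j\<in>N i. \<Sum>v<10. of_bool (inc v j) * turns i v)"
      by (intro sum.cong) (auto simp: N_def g)
    also have "\<dots> = (\<Sum>v<10. (\<Sum>j\<in>N i. of_bool (inc v j)) * turns i v)"
      by (subst sum.swap) (simp add: sum_distrib_right)
    also have "\<dots> = (\<Sum>v<10. int (card {j. j < 15 \<and> near i j \<and> inc v j}) * turns i v)"
    proof (intro sum.cong refl)
      fix v
      have "N i \<inter> {j. inc v j} = {j. j < 15 \<and> near i j \<and> inc v j}" by (auto simp: N_def)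
      then show "(\<Sum>j\<in>N i. of_bool (inc v j)) * turns i v = int (card {j. j < 15 \<and> near i j \<and> inc v j}) * turns i v"
        by (simp add: sum_of_bool_eq N_def)
    qed
    also have "even \<dots>"
      using even_near_inc[OF i] by (intro dvd_sum) auto
    finally show ?thesis .
  qed
  \<comment> \<open>Adding the swapped pairs gives a sum over ordered pairs, which can be grouped by
    the first edge.\<close>
  have "(\<Sum>(i, j)\<in>near_pairs. g i j + g j i) = (\<Sum>(i, j)\<in>near_pairs. g i j) + (\<Sum>(i, j)\<in>prod.swap ` near_pairs. g i j)"
    by (simp add: sum.distrib case_prod_beta sum.reindex)
  also have "\<dots> = (\<Sum>(i, j)\<in>near_pairs \<union> prod.swap ` near_pairs. g i j)"
    using fin by (intro sum.union_disjoint[symmetric]) (auto simp: near_pairs_def)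
  also have "near_pairs \<union> prod.swap ` near_pairs = Sigma {..<15} N"
  proof -
    have "i < j" if "j < 15" "near i j" "\<not> j < i" for i j
      using that not_near_self[of i] by (cases "i = j") auto
    then show ?thesis
      using near_sym by (auto simp: near_pairs_def N_def image_iff)
  qed
  also have "(\<Sum>(i, j)\<in>Sigma {..<15} N. g i j) = (\<Sum>i<15. \<Sum>j\<in>N i. g i j)"
    by (rule sum.Sigma[symmetric]) (auto simp: N_def)
  also have "even \<dots>" using even_g by (intro dvd_sum[of "{..<15}"]) auto
  finally have "even (\<Sum>(i, j)\<in>near_pairs. g i j + g j i)" .
  moreover have "even (\<Sum>(i, j)\<in>near_pairs. (turns i (src j) + turns j (tgt i) - turns i (tgt j) - turns j (src i)) - (g i j + g j i))"
    by (intro dvd_sum) (auto simp: g_def)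
  ultimately show ?thesis
    by (simp add: sum_subtractf case_prod_beta)
qed

theorem odd_near_crossings: "odd (card {p \<in> double_points. near (edge1 p) (edge2 p)})"
proof -
  note fin = finite_near_pairs
  let ?t = "\<lambda>(i, j). turns i (src j) + turns j (tgt i) - turns i (tgt j) - turns j (src i)"
  have "near (edge1 p) (edge2 p) \<longleftrightarrow> (edge1 p, edge2 p) \<in> near_pairs" if p: "p \<in> double_points" for p
  proof -
    obtain s t where "crossing_at p (edge1 p) (edge2 p) s t" using double_points_crossing_at_edges[OF p] .
    then show ?thesis
      using not_near_self[of "edge1 p"] by (auto simp: crossing_at_def near_pairs_def order_le_less)
  qed
  then have "card {p \<in> double_points. near (edge1 p) (edge2 p)} = card {p \<in> double_points. (edge1 p, edge2 p) \<in> near_pairs}"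
    by (metis (mono_tags, lifting) Collect_cong)
  also have "\<dots> = (\<Sum>e\<in>near_pairs. card {p \<in> double_points. (edge1 p, edge2 p) = e})"
    using finite_double_points fin by (rule card_Collect_in_eq_sum)
  \<comment> \<open>A sum has the parity of the number of its odd summands. Applied in both
    directions, this replaces the natural numbers of crossings by integers of the same
    parity.\<close>
  finally have "even (card {p \<in> double_points. near (edge1 p) (edge2 p)}) \<longleftrightarrow>
      even (card {e \<in> near_pairs. odd (card {p \<in> double_points. (edge1 p, edge2 p) = e})})"
    using fin by (simp add: even_sum_iff)
  also have "{e \<in> near_pairs. odd (card {p \<in> double_points. (edge1 p, edge2 p) = e})} =
      {e \<in> near_pairs. odd ((\<lambda>(i, j). kappa i j) e + ?t e)}"
    using near_crossings_parity by auto
  also have "even (card \<dots>) \<longleftrightarrow> even (\<Sum>e\<in>near_pairs. (\<lambda>(i, j). kappa i j) e + ?t e)"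
    using fin by (simp only: even_sum_iff)
  also have "\<dots> \<longleftrightarrow> False"
    using odd_sum_kappa even_sum_turns by (simp add: sum.distrib)
  finally show ?thesis by simp
qed

text \<open>Pairs of a cycle and a crossing on it are counted in two ways.\<close>

lemma sum_crossings:
  assumes "k \<in> {5, 6, 8, 9}"
  shows "(\<Sum>\<gamma>\<in>cycles k petersen. crossings f \<gamma>) =
    (\<Sum>p\<in>double_points. card {l \<in> set (cycle_rows k). l ! edge1 p \<and> l ! edge2 p})"
proof -
  have "inj_on row_graph (set (cycle_rows k))"
    by (rule inj_on_subset[OF inj_row_graph]) (auto simp: cycle_rows_def)
  then have "(\<Sum>\<gamma>\<in>cycles k petersen. crossings f \<gamma>) =
      (\<Sum>l\<in>set (cycle_rows k). card {p \<in> double_points. l ! edge1 p \<and> l ! edge2 p})"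
    unfolding cycles_petersen[OF assms] by (simp add: sum.reindex crossings_row_graph)
  also have "\<dots> = (\<Sum>p\<in>double_points. card {l \<in> set (cycle_rows k). l ! edge1 p \<and> l ! edge2 p})"
    by (rule sum_multicount_gen) (use finite_double_points in auto)
  finally show ?thesis .
qed

lemma double_points_edges_less: "p \<in> double_points \<Longrightarrow> edge1 p < 15" "p \<in> double_points \<Longrightarrow> edge2 p < 15"
  using double_points_crossing_at_edges[of p] by (auto simp: crossing_at_def)

lemma odd_sum_crossings:
  assumes "k \<in> {5, 6, 9}"
  shows "odd (\<Sum>\<gamma>\<in>cycles k petersen. crossings f \<gamma>)"
proof -
  have "{p \<in> double_points. odd (card {l \<in> set (cycle_rows k). l ! edge1 p \<and> l ! edge2 p})} =
      {p \<in> double_points. near (edge1 p) (edge2 p)}"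
    using odd_cycles_through[OF assms] double_points_edges_less by blast
  then show ?thesis
    using assms odd_near_crossings sum_crossings[of k] finite_double_points by (auto simp: even_sum_iff)
qed

lemma four_dvd_sum_crossings: "4 dvd (\<Sum>\<gamma>\<in>cycles 8 petersen. crossings f \<gamma>)"
proof -
  have "4 dvd (\<Sum>p\<in>double_points. card {l \<in> set (cycle_rows 8). l ! edge1 p \<and> l ! edge2 p})"
    using four_dvd_8_cycles_through double_points_edges_less by (intro dvd_sum) blast
  then show ?thesis using sum_crossings[of 8] by simp
qed

end

theorem theorem1p6:
  fixes f :: "real ^ petersen_vertex \<Rightarrow> real ^ 2"
  assumes "plane_generic_immersion petersen f"
  shows "[(\<Sum>\<gamma>\<in>cycles 5 petersen. crossings f \<gamma>) = (\<Sum>\<gamma>\<in>cycles 6 petersen. crossings f \<gamma>)] (mod 2) \<and>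
         [(\<Sum>\<gamma>\<in>cycles 6 petersen. crossings f \<gamma>) = (\<Sum>\<gamma>\<in>cycles 9 petersen. crossings f \<gamma>)] (mod 2) \<and>
         [(\<Sum>\<gamma>\<in>cycles 9 petersen. crossings f \<gamma>) = 1] (mod 2) \<and>
         [(\<Sum>\<gamma>\<in>cycles 8 petersen. crossings f \<gamma>) = 0] (mod 4)"
proof -
  interpret petersen_immersion f by standard (rule assms)
  have "(\<Sum>\<gamma>\<in>cycles k petersen. crossings f \<gamma>) mod 2 = 1" if "k \<in> {5, 6, 9}" for k
    using odd_sum_crossings[OF that] by (simp only: odd_iff_mod_2_eq_one)
  moreover have "(\<Sum>\<gamma>\<in>cycles 8 petersen. crossings f \<gamma>) mod 4 = 0"
    using four_dvd_sum_crossings by (simp only: dvd_eq_mod_eq_0)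
  ultimately show ?thesis by (simp add: cong_def)
qed

end
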